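(* Let $\boldsymbol\alpha_i=(\alpha_{i,1},\ldots,\alpha_{i,k_i})$, $i=1,\ldots,n$, be spherical chains in $\mathbb H$ such that the leftmost elements $\alpha_{1,1},\ldots,\alpha_{n,1}$ are all distinct and no three of them belong to the same conjugacy class. Let $N=\sum_{i=1}^n k_i$ and let $c_{i,j}\in\mathbb H$ ($i=1,\ldots,n$; $j=1,\ldots,k_i$) be given. Then the square confluent Vandermonde matrix $V_N^{\boldsymbol\ell}(\boldsymbol\alpha_1,\ldots,\boldsymbol\alpha_n)$ is invertible, and all polynomials $f\in\mathbb H[z]$ satisfying the interpolation conditions $$[\alpha_{i,1},\ldots,\alpha_{i,j};f]_{\boldsymbol\ell}=c_{i,j}\quad\text{for } i=1,\ldots,n;\ j=1,\ldots,k_i \qquad( * )$$ are given by the formula $$f=\widetilde f+Gh,\qquad G:=\mathbf{lrcm}\{P_{\boldsymbol\alpha_1},\ldots,P_{\boldsymbol\alpha_n}\},$$ where $h\in\mathbb H[z]$ is a free parameter, and where $$\widetilde f(z)=\begin{bmatrix}1&z&\cdots&z^{N-1}\end{bmatrix}V_N^{\boldsymbol\ell}(\boldsymbol\alpha_1,\ldots,\boldsymbol\alpha_n)^{-1}\begin{bmatrix}C_1\\ \vdots\\ C_n\end{bmatrix},\qquad C_i=\begin{bmatrix}c_{i,1}\\ \vdots\\ c_{i,k_i}\end{bmatrix},$$ is the unique solution of $( * )$ of degree less than $N$.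
   Context: $\mathbb H$ is the skew field of (real) quaternions. $\alpha\sim\beta$ means $\alpha=h^{-1}\beta h$ for some nonzero $h\in\mathbb H$; equivalence classes are called conjugacy classes. A spherical chain (of length $k$) is a tuple $(\alpha_1,\ldots,\alpha_k)$ with $\alpha_1\sim\cdots\sim\alpha_k$ and $\alpha_{j+1}\neq\overline{\alpha}_j$ for $j=1,\ldots,k-1$. $\mathbb H[z]$ is the polynomial ring in a variable $z$ commuting with quaternion coefficients. For $f(z)=\sum_{j=0}^m z^jf_j$, the left evaluation is $f^{\boldsymbol{e_\ell}}(\alpha)=\sum\alpha^jf_j$, and $L_\alpha f$ is the unique polynomial with $f=f^{\boldsymbol{e_\ell}}(\alpha)+(z-\alpha)\cdot L_\alpha f$. Left divided differences: $[\alpha_1;f]_{\boldsymbol\ell}=f^{\boldsymbol{e_\ell}}(\alpha_1)$, $[\alpha_1,\ldots,\alpha_j;f]_{\boldsymbol\ell}=(L_{\alpha_{j-1}}\cdots L_{\alpha_1}f)^{\boldsymbol{e_\ell}}(\alpha_j)$ for $j\ge 2$. For a chain $\boldsymbol\alpha=(\alpha_1,\ldots,\alpha_k)$, $V_m^{\boldsymbol\ell}(\boldsymbol\alpha)$ is the $k\times m$ matrix with $(i,j)$ entry $[\alpha_1,\ldots,\alpha_i;z^{j-1}]_{\boldsymbol\ell}$; $V_m^{\boldsymbol\ell}(\boldsymbol\alpha_1,\ldots,\boldsymbol\alpha_n)$ is obtained by stacking the blocks $V_m^{\boldsymbol\ell}(\boldsymbol\alpha_1),\ldots,V_m^{\boldsymbol\ell}(\boldsymbol\alpha_n)$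 vertically. For a chain $\boldsymbol\alpha=(\alpha_1,\ldots,\alpha_k)$, $P_{\boldsymbol\alpha}(z)=(z-\alpha_1)(z-\alpha_2)\cdots(z-\alpha_k)$. The least right common multiple $\mathbf{lrcm}(f_1,\ldots,f_n)$ of nonzero polynomials is the unique monic polynomial $G$ with $G\,\mathbb H[z]=\bigcap_i f_i\,\mathbb H[z]$ (right ideals). *)

theory Defs
  imports
    Complex_Main
    "HOL-Library.Poly_Mapping"
    "Jordan_Normal_Form.Matrix"
begin

section \<open>The skew field of quaternions\<close>

datatype quat = Quat (qre: real) (qim_i: real) (qim_j: real) (qim_k: real)

lemma quat_eq_iff:
  "x = y \<longleftrightarrow> qre x = qre y \<and> qim_i x = qim_i y \<and> qim_j x = qim_j y \<and> qim_k x = qim_k y"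
  by (cases x; cases y) simp

instantiation quat :: ring_1
begin

definition zero_quat :: quat where "0 = Quat 0 0 0 0"

definition one_quat :: quat where "1 = Quat 1 0 0 0"

definition plus_quat :: "quat \<Rightarrow> quat \<Rightarrow> quat" where
  "x + y = Quat (qre x + qre y) (qim_i x + qim_i y) (qim_j x + qim_j y) (qim_k x + qim_k y)"

definition uminus_quat :: "quat \<Rightarrow> quat" where
  "- x = Quat (- qre x) (- qim_i x) (- qim_j x) (- qim_k x)"

definition minus_quat :: "quat \<Rightarrow> quat \<Rightarrow> quat" where
  "x - y = Quat (qre x - qre y) (qim_i x - qim_i y) (qim_j x - qim_j y) (qim_k x - qim_k y)"

definition times_quat :: "quat \<Rightarrow> quat \<Rightarrow> quat" where
  "x * y = Quat
     (qre x * qre y - qim_i x * qim_i y - qim_j x * qim_j y - qim_k x * qim_k y)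
     (qre x * qim_i y + qim_i x * qre y + qim_j x * qim_k y - qim_k x * qim_j y)
     (qre x * qim_j y - qim_i x * qim_k y + qim_j x * qre y + qim_k x * qim_i y)
     (qre x * qim_k y + qim_i x * qim_j y - qim_j x * qim_i y + qim_k x * qre y)"

instance
  by standard
    (simp_all add: quat_eq_iff zero_quat_def one_quat_def plus_quat_def uminus_quat_def
      minus_quat_def times_quat_def algebra_simps)

end

definition quat_cnj :: "quat \<Rightarrow> quat" where
  "quat_cnj x = Quat (qre x) (- qim_i x) (- qim_j x) (- qim_k x)"

definition quat_norm_sq :: "quat \<Rightarrow> real" where
  "quat_norm_sq x = (qre x)\<^sup>2 + (qim_i x)\<^sup>2 + (qim_j x)\<^sup>2 + (qim_k x)\<^sup>2"

lemma quat_norm_sq_eq_0_iff: "quat_norm_sq x = 0 \<longleftrightarrow> x = 0"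
  by (auto simp: quat_norm_sq_def quat_eq_iff zero_quat_def add_nonneg_eq_0_iff)

instantiation quat :: division_ring
begin

definition inverse_quat :: "quat \<Rightarrow> quat" where
  "inverse x = Quat (qre x / quat_norm_sq x) (- qim_i x / quat_norm_sq x)
                    (- qim_j x / quat_norm_sq x) (- qim_k x / quat_norm_sq x)"

definition divide_quat :: "quat \<Rightarrow> quat \<Rightarrow> quat" where
  "x div y = x * inverse (y :: quat)"

instance
proof
  fix x y :: quat
  show "inverse x * x = 1" "x * inverse x = 1" if "x \<noteq> 0"
  proof -
    have n: "quat_norm_sq x \<noteq> 0"
      using that by (simp add: quat_norm_sq_eq_0_iff)
    have sq: "qre x * qre x / quat_norm_sq x + qim_i x * qim_i x / quat_norm_sq x
        + qim_j x * qim_j x / quat_norm_sq x + qim_k x * qim_k x / quat_norm_sq x = 1"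
      using n by (simp add: quat_norm_sq_def power2_eq_square flip: add_divide_distrib)
    then show "inverse x * x = 1" "x * inverse x = 1"
      by (simp_all add: quat_eq_iff one_quat_def times_quat_def inverse_quat_def mult.commute)
  qed
  show "x div y = x * inverse y"
    by (rule divide_quat_def)
  show "inverse (0 :: quat) = 0"
    by (simp add: inverse_quat_def zero_quat_def)
qed

end

definition quat_similar :: "quat \<Rightarrow> quat \<Rightarrow> bool" (infix \<open>\<sim>\<^sub>q\<close> 50) where
  "\<alpha> \<sim>\<^sub>q \<beta> \<longleftrightarrow> (\<exists>h. h \<noteq> 0 \<and> \<alpha> = inverse h * \<beta> * h)"

definition spherical_chain :: "quat list \<Rightarrow> bool" where
  "spherical_chain \<alpha> \<longleftrightarrow> \<alpha> \<noteq> [] \<and>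
     (\<forall>j. Suc j < length \<alpha> \<longrightarrow> \<alpha> ! j \<sim>\<^sub>q \<alpha> ! Suc j \<and> \<alpha> ! Suc j \<noteq> quat_cnj (\<alpha> ! j))"


section \<open>Quaternionic polynomials\<close>

text \<open>
  The library type of univariate polynomials has a multiplication only over commutative
  coefficients. The convolution ring of finitely supported functions on the additive monoid of
  natural numbers has no such restriction, and in it the variable commutes with all coefficients.
\<close>

type_synonym qpoly = "nat \<Rightarrow>\<^sub>0 quat"

definition qX :: qpoly where "qX = Poly_Mapping.single 1 1"

definition qconst :: "quat \<Rightarrow> qpoly" where "qconst a = Poly_Mapping.single 0 a"

definition left_eval :: "qpoly \<Rightarrow> quat \<Rightarrow> quat" where
  "left_eval f \<alpha> = (\<Sum>j\<in>Poly_Mapping.keys f. \<alpha> ^ j * Poly_Mapping.lookup f j)"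

definition left_quot :: "quat \<Rightarrow> qpoly \<Rightarrow> qpoly" where
  "left_quot \<alpha> f = (THE g. f = qconst (left_eval f \<alpha>) + (qX - qconst \<alpha>) * g)"

text \<open>\<open>fold\<close> applies \<open>left_quot\<close> first for the first element of the list.\<close>

definition left_ddiff :: "quat list \<Rightarrow> qpoly \<Rightarrow> quat" where
  "left_ddiff \<alpha> f = left_eval (fold left_quot (butlast \<alpha>) f) (last \<alpha>)"

definition chain_poly :: "quat list \<Rightarrow> qpoly" where
  "chain_poly \<alpha> = prod_list (map (\<lambda>a. qX - qconst a) \<alpha>)"

definition qmonic :: "qpoly \<Rightarrow> bool" where
  "qmonic f \<longleftrightarrow> (\<exists>d. Poly_Mapping.lookup f d = 1 \<and> (\<forall>j>d. Poly_Mapping.lookup f j = 0))"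

definition right_ideal_gen :: "qpoly \<Rightarrow> qpoly set" where
  "right_ideal_gen f = {f * g | g. True}"

definition lrcm :: "qpoly set \<Rightarrow> qpoly" where
  "lrcm F = (THE G. qmonic G \<and> right_ideal_gen G = (\<Inter>f\<in>F. right_ideal_gen f))"


section \<open>Confluent Vandermonde matrices\<close>

definition vandermonde_block :: "nat \<Rightarrow> quat list \<Rightarrow> quat mat" where
  "vandermonde_block m \<alpha> =
     mat (length \<alpha>) m (\<lambda>(i, j). left_ddiff (take (Suc i) \<alpha>) (qX ^ j))"

definition confluent_vandermonde :: "nat \<Rightarrow> quat list list \<Rightarrow> quat mat" where
  "confluent_vandermonde m \<alpha>s = foldr (@\<^sub>r) (map (vandermonde_block m) \<alpha>s) (0\<^sub>m 0 m)"

definition stack_vecs :: "'a vec list \<Rightarrow> 'a vec" where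
  "stack_vecs vs = foldr (@\<^sub>v) vs vNil"

text \<open>The inverse matrix in the library requires commutative entries.\<close>

definition inv_mat :: "'a :: semiring_1 mat \<Rightarrow> 'a mat" where
  "inv_mat A = (THE B. inverts_mat A B \<and> inverts_mat B A)"

end

theory Submission
  imports Defs
begin

text \<open>
  Everything rests on one degree bound: a nonzero polynomial in all the right ideals
  \<open>P\<^sub>i H[z]\<close> of the chains has degree at least \<open>N\<close>. It is proved by peeling off a factor:
  if \<open>f = (z - a) f'\<close> where \<open>a\<close> heads one chain, then for any other chain with head \<open>b \<noteq> a\<close> the
  identity \<open>(z - a)(z - h\<inverse>bh) = (z - b)(z - h\<inverse>ah)\<close> with \<open>h = b - a\<close> moves \<open>z - a\<close> through the
  chain and shows that \<open>f'\<close> is divisible by a conjugated chain of the same length. If \<open>a \<sim> b\<close>, the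
  new head is the conjugate of \<open>a\<close>, which by sphericity differs from the second element of the
  peeled chain; so distinctness of the heads survives there. Two other heads can only collide if
  \<open>a\<close> lies in their class, which would put three heads into one class.

  The bound makes every divided difference nonzero on the monic common multiple built from the
  preceding ones, so Newton interpolation produces both \<open>G\<close>, of degree exactly \<open>N\<close>, and a solution
  of degree less than \<open>N\<close>. Existence and uniqueness of solutions of \<open>V x = C\<close> then invert \<open>V\<close>.
\<close>

section \<open>Similarity of quaternions\<close>

lemma qre_times_commute: "qre (x * y) = qre (y * x)"
  by (simp add: times_quat_def algebra_simps)

lemma quat_norm_sq_times: "quat_norm_sq (x * y) = quat_norm_sq x * quat_norm_sq y"
  by (simp add: times_quat_def quat_norm_sq_def power2_eq_square algebra_simps)

abbreviation quat_of_real :: "real \<Rightarrow> quat" where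
  "quat_of_real r \<equiv> Quat r 0 0 0"

lemma quat_of_real_commutes: "quat_of_real r * x = x * quat_of_real r"
  by (simp add: times_quat_def algebra_simps)

text \<open>With the conjugate written as a central real number minus \<open>x\<close>, identities
  about conjugates become ring arithmetic.\<close>

lemma quat_cnj_eq: "quat_cnj x = quat_of_real (2 * qre x) - x"
  by (simp add: quat_cnj_def minus_quat_def)

lemma times_quat_cnj: "x * quat_cnj x = quat_of_real (quat_norm_sq x)"
  by (simp add: times_quat_def quat_norm_sq_def quat_cnj_def power2_eq_square algebra_simps)

lemma quat_cnj_cnj [simp]: "quat_cnj (quat_cnj x) = x"
  by (simp add: quat_cnj_def)

text \<open>Both \<open>a\<close> and \<open>b\<close> are roots of the same real quadratic
  polynomial; subtracting the two equations gives the identity. For distinct \<open>a\<close> and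
  \<open>b\<close>, the difference \<open>b - a\<close> therefore conjugates \<open>b\<close> to the
  conjugate of \<open>a\<close>.\<close>

lemma quat_intertwine:
  assumes "qre a = qre b" "quat_norm_sq a = quat_norm_sq b"
  shows "b * (b - a) = (b - a) * quat_cnj a"
proof -
  have "b * quat_cnj b = a * quat_cnj a"
    using assms by (simp add: times_quat_cnj)
  then have "b * quat_of_real (2 * qre a) - b * b = a * quat_of_real (2 * qre a) - a * a"
    using assms by (simp add: quat_cnj_eq right_diff_distrib)
  then show ?thesis
    by (simp add: quat_cnj_eq algebra_simps)
qed

text \<open>The real part is invariant because it is a trace, the norm because it is multiplicative.
  Conversely, \<open>quat_intertwine\<close> at the conjugate of \<open>a\<close> supplies the
  conjugating element \<open>b - quat_cnj a\<close>, unless this is zero.\<close>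

lemma quat_similar_iff:
  "a \<sim>\<^sub>q b \<longleftrightarrow> qre a = qre b \<and> quat_norm_sq a = quat_norm_sq b"
proof
  assume "a \<sim>\<^sub>q b"
  then obtain h where h: "h \<noteq> 0" "a = inverse h * b * h"
    by (auto simp: quat_similar_def)
  have "qre a = qre (h * (inverse h * b))"
    unfolding h(2) by (rule qre_times_commute)
  also have "h * (inverse h * b) = b"
    using h(1) by (simp flip: mult.assoc)
  finally have re: "qre a = qre b" .
  have "quat_norm_sq (inverse h) * quat_norm_sq h = quat_norm_sq (inverse h * h)"
    by (simp only: quat_norm_sq_times)
  also have "\<dots> = 1"
    using h(1) by (simp add: one_quat_def quat_norm_sq_def)
  finally have "quat_norm_sq a = quat_norm_sq b"
    unfolding h(2) quat_norm_sq_times by (simp add: algebra_simps)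
  with re show "qre a = qre b \<and> quat_norm_sq a = quat_norm_sq b"
    by simp
next
  assume ab: "qre a = qre b \<and> quat_norm_sq a = quat_norm_sq b"
  have "\<exists>h. h \<noteq> 0 \<and> b * h = h * a"
  proof (cases "b = quat_cnj a")
    case False
    have "b * (b - quat_cnj a) = (b - quat_cnj a) * quat_cnj (quat_cnj a)"
      by (rule quat_intertwine) (use ab in \<open>auto simp: quat_cnj_def quat_norm_sq_def\<close>)
    with False show ?thesis
      by (intro exI[of _ "b - quat_cnj a"]) simp
  next
    case b: True
    \<comment> \<open>Here any nonzero purely imaginary \<open>h\<close> orthogonal to the imaginary part of \<open>a\<close> works.\<close>
    show ?thesis
    proof (cases "qim_i a = 0 \<and> qim_j a = 0")
      case True
      then show ?thesis
        by (intro exI[of _ "Quat 0 1 0 0"])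
          (simp add: b quat_cnj_def times_quat_def quat_eq_iff zero_quat_def)
    next
      case False
      then show ?thesis
        by (intro exI[of _ "Quat 0 (- qim_j a) (qim_i a) 0"])
          (auto simp: b quat_cnj_def times_quat_def quat_eq_iff zero_quat_def algebra_simps)
    qed
  qed
  then obtain h where "h \<noteq> 0" "b * h = h * a"
    by blast
  then have "a = inverse h * b * h"
    by (simp add: mult.assoc) (simp flip: mult.assoc)
  with \<open>h \<noteq> 0\<close> show "a \<sim>\<^sub>q b"
    by (auto simp: quat_similar_def)
qed

lemma quat_similar_sym: "a \<sim>\<^sub>q b \<Longrightarrow> b \<sim>\<^sub>q a"
  and quat_similar_trans: "a \<sim>\<^sub>q b \<Longrightarrow> b \<sim>\<^sub>q c \<Longrightarrow> a \<sim>\<^sub>q c"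
  by (simp_all add: quat_similar_iff)

lemma quat_similar_cnj [simp]: "quat_cnj a \<sim>\<^sub>q b \<longleftrightarrow> a \<sim>\<^sub>q b" "b \<sim>\<^sub>q quat_cnj a \<longleftrightarrow> b \<sim>\<^sub>q a"
  by (simp_all add: quat_similar_iff quat_cnj_def quat_norm_sq_def)

definition quat_conj_by :: "quat \<Rightarrow> quat \<Rightarrow> quat" where
  "quat_conj_by h x = inverse h * x * h"

lemma quat_conj_by_similar: "h \<noteq> 0 \<Longrightarrow> quat_conj_by h x \<sim>\<^sub>q x"
  by (auto simp: quat_similar_def quat_conj_by_def)

lemma times_quat_conj_by: "h \<noteq> 0 \<Longrightarrow> h * quat_conj_by h x = x * h"
  by (simp add: quat_conj_by_def flip: mult.assoc)

lemma quat_conj_by_unique: "h \<noteq> 0 \<Longrightarrow> x * h = h * y \<Longrightarrow> quat_conj_by h x = y"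
  by (simp add: quat_conj_by_def mult.assoc) (simp flip: mult.assoc)

text \<open>Conjugation is additive, and \<open>b - a\<close> conjugated by itself is
  unchanged.\<close>

lemma quat_conj_by_diff:
  assumes "b \<noteq> a"
  shows "quat_conj_by (b - a) b - quat_conj_by (b - a) a = b - a"
proof -
  let ?h = "b - a"
  have "?h * (quat_conj_by ?h b - quat_conj_by ?h a) = ?h * ?h"
    using assms by (simp add: right_diff_distrib times_quat_conj_by) (simp add: algebra_simps)
  with assms show ?thesis
    by (simp only: mult_cancel_left) simp
qed

text \<open>This matches the constant terms in the exchange of two linear factors;
  \<open>quat_conj_by_diff\<close> matches the linear terms.\<close>

lemma times_quat_conj_by_diff:
  assumes "b \<noteq> a"
  shows "a * quat_conj_by (b - a) b = b * quat_conj_by (b - a) a"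
proof -
  let ?h = "b - a"
  let ?b = "quat_conj_by ?h b" and ?a = "quat_conj_by ?h a"
  have a: "?a = ?b - ?h"
    using quat_conj_by_diff[OF assms] by (simp add: algebra_simps)
  have "?h * ?b = b * ?h"
    using assms by (simp add: times_quat_conj_by)
  then have "b * ?b - b * ?h = a * ?b"
    by (metis left_diff_distrib diff_diff_eq2 add_diff_cancel_left')
  then show ?thesis
    by (simp add: a right_diff_distrib)
qed

text \<open>Inside one conjugacy class the exchange is explicit: the first equation is
  \<open>quat_intertwine\<close>, and the second follows because the two new elements differ by
  \<open>b - a\<close>.\<close>

lemma quat_conj_by_diff_similar:
  assumes "b \<noteq> a" "a \<sim>\<^sub>q b"
  shows "quat_conj_by (b - a) b = quat_cnj a" "quat_conj_by (b - a) a = quat_cnj b"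
proof -
  show b: "quat_conj_by (b - a) b = quat_cnj a"
    by (rule quat_conj_by_unique)
      (use assms quat_intertwine[of a b] in \<open>auto simp: quat_similar_iff\<close>)
  from quat_conj_by_diff[OF assms(1)] b assms(2)
  show "quat_conj_by (b - a) a = quat_cnj b"
    by (simp add: quat_cnj_eq quat_similar_iff algebra_simps)
qed

section \<open>Coefficients of products\<close>

text \<open>Only the exponent \<open>i\<close> survives in the convolution. Monomial factors on the
  left and on the right are treated separately because coefficients do not commute.\<close>

lemma lookup_single_times:
  "Poly_Mapping.lookup (Poly_Mapping.single i a * (g :: qpoly)) k =
     (if i \<le> k then a * Poly_Mapping.lookup g (k - i) else 0)"
proof -
  have "Poly_Mapping.lookup (Poly_Mapping.single i a * g) k =
      Sum_any (\<lambda>l. (a when i = l) * Sum_any (\<lambda>q. Poly_Mapping.lookup g q when k = l + q))"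
    by (simp add: lookup_mult lookup_single)
  also have "\<dots> = a * Sum_any (\<lambda>q. Poly_Mapping.lookup g q when k = i + q)"
    by (subst Sum_any.expand_superset[of "{i}"]) (auto simp: when_def split: if_splits)
  also have "Sum_any (\<lambda>q. Poly_Mapping.lookup g q when k = i + q) =
      (if i \<le> k then Poly_Mapping.lookup g (k - i) else 0)"
    by (subst Sum_any.expand_superset[of "{k - i}"]) (auto simp: when_def split: if_splits)
  finally show ?thesis
    by simp
qed

lemma lookup_times_single:
  "Poly_Mapping.lookup ((g :: qpoly) * Poly_Mapping.single i a) k =
     (if i \<le> k then Poly_Mapping.lookup g (k - i) * a else 0)"
proof -
  have "Sum_any (\<lambda>q. Poly_Mapping.lookup (Poly_Mapping.single i a) q when k = l + q) =
      (a when k = l + i)" for l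
    by (subst Sum_any.expand_superset[of "{i}"])
      (auto simp: when_def lookup_single split: if_splits)
  then have "Poly_Mapping.lookup (g * Poly_Mapping.single i a) k =
      Sum_any (\<lambda>l. Poly_Mapping.lookup g l * (a when k = l + i))"
    by (simp add: lookup_mult)
  also have "\<dots> = (if i \<le> k then Poly_Mapping.lookup g (k - i) * a else 0)"
    by (subst Sum_any.expand_superset[of "{k - i}"]) (auto simp: when_def split: if_splits)
  finally show ?thesis .
qed

lemma lookup_times_qconst [simp]:
  "Poly_Mapping.lookup (g * qconst a) k = Poly_Mapping.lookup g k * a"
  by (simp add: qconst_def lookup_times_single)

lemma qX_commutes: "qX * g = g * qX"
  by (rule poly_mapping_eqI) (simp add: qX_def lookup_single_times lookup_times_single)

lemma qX_power: "qX ^ j = Poly_Mapping.single j 1"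
  by (induction j) (simp_all add: qX_def mult_single)

lemma lookup_qconst: "Poly_Mapping.lookup (qconst a) k = (if k = 0 then a else 0)"
  by (simp add: qconst_def lookup_single when_def)

lemma qconst_add: "qconst (a + b) = qconst a + qconst b"
  and qconst_diff: "qconst (a - b) = qconst a - qconst b"
  and qconst_times: "qconst (a * b) = qconst a * qconst b"
  and qconst_0 [simp]: "qconst 0 = 0"
  by (simp_all add: qconst_def single_add single_diff mult_single)

text \<open>The product depends only on \<open>a + b\<close> and \<open>a * b\<close>, so two such
  products agree as soon as these agree.\<close>

lemma qX_minus_times:
  "(qX - qconst a) * (qX - qconst b) = qX * qX - qX * qconst (a + b) + qconst (a * b)"
  by (simp add: algebra_simps qconst_add qconst_times qX_commutes[of "qconst a"])


section \<open>Degree bounds, monic polynomials and division with remainder\<close>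

definition deg_less :: "nat \<Rightarrow> qpoly \<Rightarrow> bool" where
  "deg_less d f \<longleftrightarrow> (\<forall>j\<ge>d. Poly_Mapping.lookup f j = 0)"

definition monic_deg :: "nat \<Rightarrow> qpoly \<Rightarrow> bool" where
  "monic_deg d G \<longleftrightarrow> Poly_Mapping.lookup G d = 1 \<and> deg_less (Suc d) G"

lemma deg_less_mono: "deg_less d f \<Longrightarrow> d \<le> e \<Longrightarrow> deg_less e f"
  by (simp add: deg_less_def)

text \<open>The strict bound gives the zero polynomial a natural place, with no convention about its
  degree.\<close>

lemma deg_less_0_iff [simp]: "deg_less 0 f \<longleftrightarrow> f = 0"
  by (auto simp: deg_less_def intro: poly_mapping_eqI)

lemma deg_less_zero [simp]: "deg_less d 0"
  by (simp add: deg_less_def)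

lemma deg_less_add: "deg_less d f \<Longrightarrow> deg_less d g \<Longrightarrow> deg_less d (f + g)"
  and deg_less_diff: "deg_less d f \<Longrightarrow> deg_less d g \<Longrightarrow> deg_less d (f - g)"
  and deg_less_times_qconst: "deg_less d f \<Longrightarrow> deg_less d (f * qconst a)"
  by (simp_all add: deg_less_def lookup_add lookup_minus)

lemma deg_less_exists: "\<exists>d. deg_less d f"
proof (intro exI)
  show "deg_less (Suc (Max (insert 0 (Poly_Mapping.keys f)))) f"
    unfolding deg_less_def
  proof (intro allI impI, rule ccontr)
    fix j
    assume j: "Suc (Max (insert 0 (Poly_Mapping.keys f))) \<le> j" "Poly_Mapping.lookup f j \<noteq> 0"
    then have "j \<in> insert 0 (Poly_Mapping.keys f)"
      by (simp add: in_keys_iff)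
    then have "j \<le> Max (insert 0 (Poly_Mapping.keys f))"
      by (intro Max_ge) simp_all
    with j show False
      by simp
  qed
qed

lemma deg_less_1_iff: "deg_less 1 f \<longleftrightarrow> f = qconst (Poly_Mapping.lookup f 0)"
proof
  assume "deg_less 1 f"
  then show "f = qconst (Poly_Mapping.lookup f 0)"
    by (intro poly_mapping_eqI) (auto simp: lookup_qconst deg_less_def)
next
  assume f: "f = qconst (Poly_Mapping.lookup f 0)"
  show "deg_less 1 f"
    by (subst f) (simp add: deg_less_def lookup_qconst)
qed

lemma nonzero_top_coeff:
  assumes "f \<noteq> 0"
  obtains m where "Poly_Mapping.lookup f m \<noteq> 0" "deg_less (Suc m) f"
proof -
  define m where "m = (LEAST d. deg_less d f)"
  have m: "deg_less m f"
    unfolding m_def by (rule LeastI_ex) (rule deg_less_exists)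
  with assms have "m \<noteq> 0"
    by (cases m) auto
  then obtain k where k: "m = Suc k"
    by (cases m) auto
  have "\<not> deg_less k f"
    unfolding m_def by (rule not_less_Least) (use k in \<open>simp add: m_def\<close>)
  then have "Poly_Mapping.lookup f k \<noteq> 0"
    using m k by (metis deg_less_def not_less_eq_eq le_antisym)
  with m k that show thesis
    by blast
qed

text \<open>A polynomial is built up by adding ever higher monomials. The condition
  \<open>m < n\<close> keeps the overall degree bound available in the step.\<close>

lemma deg_less_induct [consumes 1, case_names zero step]:
  assumes "deg_less n f"
    and "P 0"
    and "\<And>f m a. deg_less m f \<Longrightarrow> m < n \<Longrightarrow> P f \<Longrightarrow> P (f + Poly_Mapping.single m a)"
  shows "P f"
  using assms(1,3)
proof (induction n arbitrary: f)
  case 0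
  with assms(2) show ?case
    by simp
next
  case (Suc n)
  let ?a = "Poly_Mapping.lookup f n"
  let ?g = "f - Poly_Mapping.single n ?a"
  have g: "deg_less n ?g"
    using Suc.prems(1)
    by (auto simp: deg_less_def lookup_minus lookup_single when_def Suc_le_eq)
  then have "P ?g"
    by (rule Suc.IH) (use Suc.prems(2) in simp)
  with Suc.prems(2)[OF g, of ?a] show ?case
    by simp
qed

lemma deg_less_single: "m < d \<Longrightarrow> deg_less d (Poly_Mapping.single m a)"
  by (auto simp: deg_less_def lookup_single when_def)

text \<open>Only the two top coefficients meet at exponent \<open>d + m\<close>. The induction adds
  one monomial of \<open>f\<close> at a time and keeps \<open>g\<close> fixed.\<close>

lemma deg_less_times:
  assumes "deg_less (Suc d) f" "deg_less (Suc m) g"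
  shows "deg_less (Suc (d + m)) (f * g)"
    and "Poly_Mapping.lookup (f * g) (d + m) = Poly_Mapping.lookup f d * Poly_Mapping.lookup g m"
proof -
  have "deg_less (Suc (d + m)) (f * g) \<and>
    Poly_Mapping.lookup (f * g) (d + m) = Poly_Mapping.lookup f d * Poly_Mapping.lookup g m"
    using assms(1)
  proof (induction rule: deg_less_induct)
    case (step f k a)
    have "deg_less (Suc (d + m)) (Poly_Mapping.single k a * g)"
      using step.hyps(2) assms(2) by (auto simp: deg_less_def lookup_single_times)
    moreover have "Poly_Mapping.lookup (Poly_Mapping.single k a * g) (d + m) =
        Poly_Mapping.lookup (Poly_Mapping.single k a) d * Poly_Mapping.lookup g m"
      using step.hyps(2) assms(2)
      by (cases "k = d") (auto simp: deg_less_def lookup_single_times lookup_single when_def)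
    ultimately show ?case
      using step.IH by (auto simp: algebra_simps lookup_add intro: deg_less_add)
  qed simp
  then show "deg_less (Suc (d + m)) (f * g)"
    and "Poly_Mapping.lookup (f * g) (d + m) = Poly_Mapping.lookup f d * Poly_Mapping.lookup g m"
    by auto
qed

lemma monic_deg_nonzero: "monic_deg d G \<Longrightarrow> G \<noteq> 0"
  by (auto simp: monic_deg_def)

lemma monic_deg_1 [simp]: "monic_deg 0 1"
  by (simp add: monic_deg_def deg_less_def lookup_one)

lemma monic_deg_linear [simp]: "monic_deg 1 (qX - qconst a)"
  by (auto simp: monic_deg_def deg_less_def lookup_minus lookup_qconst qX_def lookup_single)

lemma monic_deg_times: "monic_deg d f \<Longrightarrow> monic_deg e g \<Longrightarrow> monic_deg (d + e) (f * g)"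
  using deg_less_times[of d f e g] by (simp add: monic_deg_def)

text \<open>Provides the nonvanishing of a linear factor that is to be cancelled from a
  product.\<close>

lemma qX_neq_qconst [simp]: "qX \<noteq> qconst a"
  using monic_deg_nonzero[OF monic_deg_linear, of a] by simp

text \<open>The leading coefficient of \<open>u\<close> reappears unchanged in \<open>G * u\<close>,
  so the degrees add exactly.\<close>

lemma monic_deg_times_deg_less:
  assumes "monic_deg d G" "deg_less (d + e) (G * u)"
  shows "deg_less e u"
proof (cases "u = 0")
  case False
  then obtain m where m: "Poly_Mapping.lookup u m \<noteq> 0" "deg_less (Suc m) u"
    by (rule nonzero_top_coeff)
  have "Poly_Mapping.lookup (G * u) (d + m) = Poly_Mapping.lookup u m"
    using deg_less_times(2)[of d G m u] assms(1) m(2) by (simp add: monic_deg_def)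
  with assms(2) m(1) have "m < e"
    by (metis deg_less_def add_le_cancel_left not_less)
  with m(2) show ?thesis
    by (auto intro: deg_less_mono)
qed simp

lemma monic_deg_times_eq_0:
  assumes "monic_deg d G" "deg_less d (G * u)"
  shows "u = 0"
  using monic_deg_times_deg_less[of d G 0 u] assms by simp

text \<open>Long division: since \<open>G\<close> is monic, subtracting \<open>G\<close> times a
  monomial with the leading coefficient of \<open>f\<close> removes that coefficient. The quotient
  stands on the right, as right ideals require.\<close>

lemma monic_division:
  assumes "monic_deg d G"
  shows "\<exists>q r. f = G * q + r \<and> deg_less d r"
proof -
  obtain n where "deg_less n f"
    using deg_less_exists by blast
  then show ?thesis
  proof (induction n arbitrary: f)
    case 0
    then show ?case
      by (intro exI[of _ 0]) simp
  next
    case (Suc n)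
    show ?case
    proof (cases "d \<le> n")
      case True
      define s where "s = Poly_Mapping.single (n - d) (Poly_Mapping.lookup f n)"
      have s: "deg_less (Suc (n - d)) s"
        by (simp add: s_def deg_less_single)
      have "deg_less (Suc n) (G * s)"
          "Poly_Mapping.lookup (G * s) n = Poly_Mapping.lookup f n"
        using deg_less_times[of d G "n - d" s] s assms True by (simp_all add: monic_deg_def s_def)
      with Suc.prems have "Poly_Mapping.lookup (f - G * s) j = 0" if "n \<le> j" for j
        using that by (cases "j = n") (simp_all add: lookup_minus deg_less_def)
      then have "deg_less n (f - G * s)"
        by (simp add: deg_less_def)
      from Suc.IH[OF this] obtain q r where "f - G * s = G * q + r" "deg_less d r"
        by blast
      then show ?thesis
        by (intro exI[of _ "q + s"] exI[of _ r]) (simp add: algebra_simps)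
    next
      case False
      with Suc.prems show ?thesis
        by (intro exI[of _ 0] exI[of _ f]) (auto intro: deg_less_mono)
    qed
  qed
qed

section \<open>Left evaluation and divided differences\<close>

lemma left_eval_superset:
  assumes "finite S" "Poly_Mapping.keys f \<subseteq> S"
  shows "left_eval f a = (\<Sum>j\<in>S. a ^ j * Poly_Mapping.lookup f j)"
  unfolding left_eval_def by (rule sum.mono_neutral_left) (use assms in \<open>auto simp: in_keys_iff\<close>)

lemma left_eval_add: "left_eval (f + g) a = left_eval f a + left_eval g a"
proof -
  let ?S = "Poly_Mapping.keys f \<union> Poly_Mapping.keys g"
  have "left_eval p a = (\<Sum>j\<in>?S. a ^ j * Poly_Mapping.lookup p j)"
    if "p \<in> {f, g, f + g}" for p
    by (rule left_eval_superset) (use that Poly_Mapping.keys_add[of f g] in auto)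
  then show ?thesis
    by (simp add: lookup_add distrib_left sum.distrib)
qed

lemma left_eval_single: "left_eval (Poly_Mapping.single j c) a = a ^ j * c"
  by (simp add: left_eval_superset[of "{j}"])

lemma left_eval_qconst [simp]: "left_eval (qconst c) a = c"
  by (simp add: qconst_def left_eval_single)

text \<open>Coefficients stand to the right of the powers of \<open>a\<close>, so evaluation is
  right linear.\<close>

lemma left_eval_times_qconst: "left_eval (f * qconst c) a = left_eval f a * c"
proof -
  have "left_eval (f * qconst c) a =
      (\<Sum>j\<in>Poly_Mapping.keys f. a ^ j * Poly_Mapping.lookup (f * qconst c) j)"
    by (rule left_eval_superset) (auto simp: in_keys_iff)
  then show ?thesis
    by (simp add: left_eval_def sum_distrib_right mult.assoc)
qed

text \<open>Left evaluation is not multiplicative, so this is checked on monomials, where the two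
  terms \<open>a ^ Suc m * c\<close> and \<open>a ^ m * (a * c)\<close> cancel.\<close>

lemma left_eval_linear_times [simp]: "left_eval ((qX - qconst a) * f) a = 0"
proof -
  obtain n where "deg_less n f"
    using deg_less_exists by blast
  then show ?thesis
  proof (induction rule: deg_less_induct)
    case (step f m c)
    have "(qX - qconst a) * Poly_Mapping.single m c =
        Poly_Mapping.single (Suc m) c + Poly_Mapping.single m (- (a * c))"
      by (simp add: left_diff_distrib qX_def qconst_def mult_single single_uminus)
    then have "left_eval ((qX - qconst a) * Poly_Mapping.single m c) a = 0"
      by (simp add: left_eval_add left_eval_single power_commutes flip: mult.assoc)
    with step.IH show ?case
      by (simp add: distrib_left left_eval_add)
  qed (simp add: left_eval_def)
qed

text \<open>Evaluation annihilates the multiple of the linear factor and thus reads off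
  \<open>r\<close>; cancelling the linear factor then determines \<open>g\<close>.\<close>

lemma left_quot_unique:
  assumes "f = qconst r + (qX - qconst a) * g"
  shows "left_eval f a = r" "left_quot a f = g"
proof -
  show ev: "left_eval f a = r"
    by (simp add: assms left_eval_add)
  show "left_quot a f = g"
    unfolding left_quot_def ev
    by (rule the_equality) (use assms in auto)
qed

text \<open>Existence comes from division by a monic polynomial of degree one, whose remainder is
  constant.\<close>

lemma left_quot_eq: "f = qconst (left_eval f a) + (qX - qconst a) * left_quot a f"
proof -
  obtain q r where qr: "f = (qX - qconst a) * q + r" "deg_less 1 r"
    using monic_division[OF monic_deg_linear] by blast
  then have "f = qconst (Poly_Mapping.lookup r 0) + (qX - qconst a) * q"
    using deg_less_1_iff[of r] by (metis add.commute)
  with left_quot_unique[OF this] show ?thesis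
    by simp
qed

lemma left_quot_add: "left_quot a (f + g) = left_quot a f + left_quot a g"
proof (rule left_quot_unique(2))
  show "f + g = qconst (left_eval f a + left_eval g a) +
      (qX - qconst a) * (left_quot a f + left_quot a g)"
    using arg_cong2[OF left_quot_eq[of f a] left_quot_eq[of g a], of "(+)"]
    by (simp only: qconst_add distrib_left add_ac)
qed

lemma left_quot_times_qconst: "left_quot a (f * qconst c) = left_quot a f * qconst c"
proof (rule left_quot_unique(2))
  show "f * qconst c = qconst (left_eval f a * c) + (qX - qconst a) * (left_quot a f * qconst c)"
    using left_quot_eq[of f a] by (metis qconst_times distrib_right mult.assoc)
qed

lemma left_ddiff_single: "left_ddiff [a] f = left_eval f a"
  by (simp add: left_ddiff_def)

lemma left_ddiff_Cons: "as \<noteq> [] \<Longrightarrow> left_ddiff (a # as) f = left_ddiff as (left_quot a f)"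
  by (simp add: left_ddiff_def)

lemma left_ddiff_add: "left_ddiff as (f + g) = left_ddiff as f + left_ddiff as g"
proof -
  have "fold left_quot bs (f + g) = fold left_quot bs f + fold left_quot bs g" for bs
    by (induction bs arbitrary: f g) (simp_all add: left_quot_add)
  then show ?thesis
    by (simp add: left_ddiff_def left_eval_add)
qed

text \<open>Together with additivity this makes each divided difference a right linear functional,
  determined on a polynomial by its values on the powers of the variable.\<close>

lemma left_ddiff_times_qconst: "left_ddiff as (f * qconst c) = left_ddiff as f * c"
proof -
  have "fold left_quot bs (f * qconst c) = fold left_quot bs f * qconst c" for bs
    by (induction bs arbitrary: f) (simp_all add: left_quot_times_qconst)
  then show ?thesis
    by (simp add: left_ddiff_def left_eval_times_qconst)
qed

lemma left_ddiff_0 [simp]: "left_ddiff as 0 = 0"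
  using left_ddiff_times_qconst[of as 0 0] by simp

lemma left_ddiff_diff: "left_ddiff as (f - g) = left_ddiff as f - left_ddiff as g"
  using left_ddiff_add[of as "f - g" g] by (simp add: algebra_simps)

lemma left_ddiff_sum: "left_ddiff as (\<Sum>x\<in>S. f x) = (\<Sum>x\<in>S. left_ddiff as (f x))"
  by (induction S rule: infinite_finite_induct) (simp_all add: left_ddiff_add)

section \<open>Chain products and principal right ideals\<close>

lemma chain_poly_Nil [simp]: "chain_poly [] = 1"
  and chain_poly_Cons [simp]: "chain_poly (a # as) = (qX - qconst a) * chain_poly as"
  by (simp_all add: chain_poly_def)

lemma right_ideal_gen_iff: "f \<in> right_ideal_gen P \<longleftrightarrow> (\<exists>g. f = P * g)"
  by (auto simp: right_ideal_gen_def)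

lemma right_ideal_gen_1 [simp]: "right_ideal_gen 1 = UNIV"
  by (auto simp: right_ideal_gen_def)

lemma right_ideal_gen_times: "f \<in> right_ideal_gen P \<Longrightarrow> f * g \<in> right_ideal_gen P"
  by (auto simp: right_ideal_gen_iff mult.assoc)

lemma right_ideal_gen_diff:
  "f \<in> right_ideal_gen P \<Longrightarrow> g \<in> right_ideal_gen P \<Longrightarrow> f - g \<in> right_ideal_gen P"
  by (auto simp: right_ideal_gen_iff simp flip: right_diff_distrib)

text \<open>The first condition splits off the factor \<open>qX - qconst a\<close>; the remaining
  ones are the same conditions for the quotient and the tail of the chain.\<close>

lemma left_ddiffs_zero_iff:
  "(\<forall>j<length as. left_ddiff (take (Suc j) as) f = 0) \<longleftrightarrow> f \<in> right_ideal_gen (chain_poly as)"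
proof (induction as arbitrary: f)
  case (Cons a as)
  let ?q = "left_quot a f"
  have "(\<forall>j<length (a # as). left_ddiff (take (Suc j) (a # as)) f = 0) \<longleftrightarrow>
      left_eval f a = 0 \<and> (\<forall>j<length as. left_ddiff (a # take (Suc j) as) f = 0)"
    unfolding length_Cons All_less_Suc2 by (simp add: left_ddiff_single)
  also have "\<dots> \<longleftrightarrow> left_eval f a = 0 \<and> (\<forall>j<length as. left_ddiff (take (Suc j) as) ?q = 0)"
    by (intro conj_cong refl all_cong) (subst left_ddiff_Cons, auto)
  also have "\<dots> \<longleftrightarrow> left_eval f a = 0 \<and> ?q \<in> right_ideal_gen (chain_poly as)"
    by (simp add: Cons.IH)
  also have "\<dots> \<longleftrightarrow> f \<in> right_ideal_gen (chain_poly (a # as))"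
  proof
    assume "left_eval f a = 0 \<and> ?q \<in> right_ideal_gen (chain_poly as)"
    with left_quot_eq[of f a] show "f \<in> right_ideal_gen (chain_poly (a # as))"
      by (auto simp: right_ideal_gen_iff mult.assoc)
  next
    assume "f \<in> right_ideal_gen (chain_poly (a # as))"
    then obtain g where "f = qconst 0 + (qX - qconst a) * (chain_poly as * g)"
      by (auto simp: right_ideal_gen_iff mult.assoc)
    from left_quot_unique[OF this]
    show "left_eval f a = 0 \<and> ?q \<in> right_ideal_gen (chain_poly as)"
      by (auto simp: right_ideal_gen_iff)
  qed
  finally show ?case .
qed simp


section \<open>Moving a linear factor through a chain\<close>

definition chain_step :: "quat \<Rightarrow> quat \<Rightarrow> bool" where
  "chain_step a b \<longleftrightarrow> a \<sim>\<^sub>q b \<and> b \<noteq> quat_cnj a"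

lemma spherical_chain_iff: "spherical_chain as \<longleftrightarrow> as \<noteq> [] \<and> successively chain_step as"
  by (simp add: spherical_chain_def successively_conv_nth chain_step_def)

text \<open>The exchange identity is applied along the chain from the left: each \<open>b\<close> is
  replaced by its conjugate, and the conjugate of \<open>a\<close> travels on to the next
  factor.\<close>

fun shift_chain :: "quat \<Rightarrow> quat list \<Rightarrow> quat list" where
  "shift_chain a [] = []"
| "shift_chain a (b # bs) = quat_conj_by (b - a) b # shift_chain (quat_conj_by (b - a) a) bs"

lemma length_shift_chain [simp]: "length (shift_chain a bs) = length bs"
  by (induction bs arbitrary: a) simp_all

lemma shift_chain_eq_Nil_iff [simp]: "shift_chain a bs = [] \<longleftrightarrow> bs = []"
  by (cases bs) simp_all

lemma hd_shift_chain:
  "bs \<noteq> [] \<Longrightarrow> hd (shift_chain a bs) = quat_conj_by (hd bs - a) (hd bs)"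
  by (cases bs) simp_all

text \<open>Equality would put \<open>a\<close> in the class of \<open>b\<close>, where the
  travelling element is the conjugate of \<open>b\<close>, and a chain forbids this as successor of
  \<open>b\<close>. Hence the next exchange again involves distinct elements.\<close>

lemma chain_step_neq_shift:
  assumes "b \<noteq> a" "chain_step b c"
  shows "c \<noteq> quat_conj_by (b - a) a"
proof
  assume c: "c = quat_conj_by (b - a) a"
  with assms have "c \<sim>\<^sub>q a"
    by (simp add: quat_conj_by_similar)
  with assms(2) have "a \<sim>\<^sub>q b"
    by (metis chain_step_def quat_similar_sym quat_similar_trans)
  with assms c show False
    by (simp add: quat_conj_by_diff_similar chain_step_def)
qed

text \<open>Conjugation preserves classes, so only the forbidden conjugate successor has to be
  excluded. If \<open>a\<close> is similar to \<open>b\<close>, all new elements are explicit and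
  \<open>a = b\<close> would follow.\<close>

lemma chain_step_shift:
  assumes "b \<noteq> a" "chain_step b c"
  defines "a' \<equiv> quat_conj_by (b - a) a"
  shows "chain_step (quat_conj_by (b - a) b) (quat_conj_by (c - a') c)"
proof -
  define b' where "b' = quat_conj_by (b - a) b"
  define c' where "c' = quat_conj_by (c - a') c"
  have ca: "c \<noteq> a'"
    using chain_step_neq_shift[OF assms(1,2)] by (simp add: a'_def)
  have bc: "b \<sim>\<^sub>q c" "c \<noteq> quat_cnj b"
    using assms(2) by (simp_all add: chain_step_def)
  have b': "b' \<sim>\<^sub>q b" and c': "c' \<sim>\<^sub>q c"
    using assms(1) ca by (simp_all add: b'_def c'_def quat_conj_by_similar)
  have "c' \<noteq> quat_cnj b'"
  proof
    assume eq: "c' = quat_cnj b'"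
    show False
    proof (cases "a \<sim>\<^sub>q b")
      case True
      then have a': "a' = quat_cnj b" and b'_eq: "b' = quat_cnj a"
        using assms(1) by (simp_all add: a'_def b'_def quat_conj_by_diff_similar)
      from a' bc(1) have "a' \<sim>\<^sub>q c"
        by simp
      then have "c' = b"
        using ca by (simp add: c'_def quat_conj_by_diff_similar a')
      with eq b'_eq assms(1) show False
        by simp
    next
      case False
      \<comment> \<open>Otherwise \<open>(z - c)(z - a'') = (z - cnj b)(z - a)\<close>, which makes \<open>c\<close> conjugate to \<open>a\<close>.\<close>
      define a'' where "a'' = quat_conj_by (c - a') a'"
      \<comment> \<open>The class of zero is a singleton, so \<open>b = 0\<close> would force
        \<open>c = 0 = quat_cnj b\<close>.\<close>
      have "b \<noteq> 0"
        using bc by (metis quat_similar_iff quat_norm_sq_eq_0_iff quat_similar_cnj(1))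
      \<comment> \<open>Constant terms: \<open>b * a' = a * b'\<close>, and the assumed value of
        \<open>c'\<close> turns \<open>b' * c'\<close> into the norm of \<open>b\<close>, which is
        real and hence central.\<close>
      have "b * (a' * c') = a * (b' * quat_cnj b')"
        using times_quat_conj_by_diff[OF assms(1)] eq
        by (simp add: a'_def b'_def mult.assoc[symmetric])
      also have "b' * quat_cnj b' = b * quat_cnj b"
        using b' by (simp add: times_quat_cnj quat_similar_iff)
      also have "a * (b * quat_cnj b) = b * (quat_cnj b * a)"
        by (metis times_quat_cnj quat_of_real_commutes mult.assoc)
      finally have "a' * c' = quat_cnj b * a"
        using \<open>b \<noteq> 0\<close> by simp
      then have prod: "c * a'' = quat_cnj b * a"
        using times_quat_conj_by_diff[OF ca] by (simp add: a''_def c'_def)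
      have diffs: "c' - a'' = c - a'" "b' - a' = b - a"
        using quat_conj_by_diff[OF ca] quat_conj_by_diff[OF assms(1)]
        by (simp_all add: a''_def c'_def b'_def a'_def)
      have c'_eq: "c' = quat_cnj b + b - b'"
        using eq b' by (simp add: quat_cnj_eq quat_similar_iff)
      have "a'' = c' - (c - a')"
        by (simp flip: diffs(1))
      then have "a'' = quat_cnj b + b - ((b' - a') + c)"
        unfolding c'_eq by (simp add: algebra_simps)
      then have "a'' = quat_cnj b + a - c"
        unfolding diffs(2) by (simp add: algebra_simps)
      \<comment> \<open>Eliminating \<open>a''\<close> between the product and the sum relation
        shows that \<open>c - quat_cnj b\<close>, nonzero by the chain condition, conjugates
        \<open>c\<close> to \<open>a\<close>.\<close>
      with prod have "c * (c - quat_cnj b) = (c - quat_cnj b) * a"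
        by (simp add: algebra_simps)
      with bc(2) have "quat_conj_by (c - quat_cnj b) c = a"
        by (intro quat_conj_by_unique) simp_all
      with bc have "a \<sim>\<^sub>q c"
        by (metis quat_conj_by_similar right_minus_eq)
      with bc(1) False show False
        by (metis quat_similar_sym quat_similar_trans)
    qed
  qed
  moreover have "b' \<sim>\<^sub>q c'"
    using b' c' bc(1) by (simp add: quat_similar_iff)
  ultimately show ?thesis
    by (simp add: chain_step_def b'_def c'_def)
qed

lemma successively_shift_chain:
  assumes "successively chain_step bs" "bs = [] \<or> hd bs \<noteq> a"
  shows "successively chain_step (shift_chain a bs)"
  using assms
proof (induction bs arbitrary: a)
  case (Cons b bs)
  show ?case
  proof (cases bs)
    case (Cons c cs)
    with Cons.prems have step: "b \<noteq> a" "chain_step b c" "successively chain_step bs"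
      by simp_all
    then have "successively chain_step (shift_chain (quat_conj_by (b - a) a) bs)"
      using chain_step_neq_shift[of b a c] Cons by (intro Cons.IH) simp_all
    with chain_step_shift[OF step(1,2)] Cons show ?thesis
      by simp
  qed simp
qed simp

text \<open>Dividing \<open>f\<close> by the exchanged factor leaves a constant \<open>r\<close>.
  Subtracting the known common multiple puts \<open>(qX - qconst a) * qconst r\<close> into the
  right ideal of \<open>qX - qconst b\<close>, and evaluation at \<open>b\<close> gives
  \<open>(b - a) * r = 0\<close>.\<close>

lemma linear_common_multiple:
  assumes "b \<noteq> a" and eq: "(qX - qconst a) * f = (qX - qconst b) * g"
  obtains u where "f = (qX - qconst (quat_conj_by (b - a) b)) * u"
    and "g = (qX - qconst (quat_conj_by (b - a) a)) * u"
proof -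
  let ?a = "quat_conj_by (b - a) a" and ?b = "quat_conj_by (b - a) b"
  define u where "u = left_quot ?b f"
  define r where "r = left_eval f ?b"
  have f: "f = qconst r + (qX - qconst ?b) * u"
    unfolding r_def u_def by (rule left_quot_eq)
  have "a + ?b = b + ?a"
    using quat_conj_by_diff[OF assms(1)] by (simp add: algebra_simps)
  then have comm: "(qX - qconst a) * (qX - qconst ?b) = (qX - qconst b) * (qX - qconst ?a)"
    using times_quat_conj_by_diff[OF assms(1)] by (simp add: qX_minus_times)
  then have comm_u: "(qX - qconst a) * ((qX - qconst ?b) * u) = (qX - qconst b) * ((qX - qconst ?a) * u)"
    by (simp only: flip: mult.assoc)
  have "(qX - qconst a) * qconst r =
      (qX - qconst a) * f - (qX - qconst a) * ((qX - qconst ?b) * u)"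
    by (simp add: f right_diff_distrib distrib_left)
  also have "\<dots> = (qX - qconst b) * (g - (qX - qconst ?a) * u)"
    by (simp only: eq comm_u right_diff_distrib)
  finally have r: "(qX - qconst a) * qconst r = (qX - qconst b) * (g - (qX - qconst ?a) * u)" .
  have "(qX - qconst a) * qconst r = (qX - qconst b) * qconst r + qconst ((b - a) * r)"
    by (simp add: left_diff_distrib qconst_times qconst_diff)
  with r have "(b - a) * r = 0"
    by (metis left_eval_add left_eval_linear_times left_eval_qconst add_0)
  with assms(1) have "r = 0"
    by simp
  with r f that[of u] show thesis
    by simp
qed

text \<open>At each factor \<open>linear_common_multiple\<close> splits off the conjugated head and
  hands the cofactor \<open>u\<close>, with the conjugate of \<open>a\<close>, on to the
  tail.\<close>

lemma shift_chain_ideal: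
  assumes "successively chain_step bs" "bs = [] \<or> hd bs \<noteq> a"
    and "(qX - qconst a) * f \<in> right_ideal_gen (chain_poly bs)"
  shows "f \<in> right_ideal_gen (chain_poly (shift_chain a bs))"
  using assms
proof (induction bs arbitrary: a f)
  case (Cons b bs)
  from Cons.prems obtain g where g: "(qX - qconst a) * f = (qX - qconst b) * (chain_poly bs * g)"
    by (auto simp: right_ideal_gen_iff mult.assoc)
  from Cons.prems have "b \<noteq> a"
    by simp
  from linear_common_multiple[OF this g] obtain u
    where f: "f = (qX - qconst (quat_conj_by (b - a) b)) * u"
      and u: "chain_poly bs * g = (qX - qconst (quat_conj_by (b - a) a)) * u" .
  have "u \<in> right_ideal_gen (chain_poly (shift_chain (quat_conj_by (b - a) a) bs))"
  proof (rule Cons.IH)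
    show "successively chain_step bs" "bs = [] \<or> hd bs \<noteq> quat_conj_by (b - a) a"
      using Cons.prems chain_step_neq_shift[OF \<open>b \<noteq> a\<close>] by (auto simp: successively_Cons)
    show "(qX - qconst (quat_conj_by (b - a) a)) * u \<in> right_ideal_gen (chain_poly bs)"
      by (auto simp: right_ideal_gen_iff simp flip: u)
  qed
  with f show ?case
    by (auto simp: right_ideal_gen_iff mult.assoc)
qed simp

section \<open>Independence of spherical chains\<close>

text \<open>
  Peeling eventually exhausts chains, so empty chains are allowed and exempt from the conditions
  on heads (\<open>hd []\<close> is an arbitrary value).
\<close>

definition admissible :: "'i set \<Rightarrow> ('i \<Rightarrow> quat list) \<Rightarrow> bool" where
  "admissible I \<beta> \<longleftrightarrow> (\<forall>i\<in>I. successively chain_step (\<beta> i)) \<and>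
     (\<forall>i\<in>I. \<forall>j\<in>I. i \<noteq> j \<longrightarrow> \<beta> i \<noteq> [] \<longrightarrow> \<beta> j \<noteq> [] \<longrightarrow> hd (\<beta> i) \<noteq> hd (\<beta> j)) \<and>
     (\<forall>i\<in>I. \<forall>j\<in>I. \<forall>k\<in>I. i \<noteq> j \<longrightarrow> j \<noteq> k \<longrightarrow> i \<noteq> k \<longrightarrow> \<beta> i \<noteq> [] \<longrightarrow> \<beta> j \<noteq> [] \<longrightarrow> \<beta> k \<noteq> [] \<longrightarrow>
        \<not> (hd (\<beta> i) \<sim>\<^sub>q hd (\<beta> j) \<and> hd (\<beta> j) \<sim>\<^sub>q hd (\<beta> k)))"

lemma admissibleD:
  assumes "admissible I \<beta>"
  shows "i \<in> I \<Longrightarrow> successively chain_step (\<beta> i)"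
    and "i \<in> I \<Longrightarrow> j \<in> I \<Longrightarrow> i \<noteq> j \<Longrightarrow> \<beta> i \<noteq> [] \<Longrightarrow> \<beta> j \<noteq> [] \<Longrightarrow> hd (\<beta> i) \<noteq> hd (\<beta> j)"
    and "i \<in> I \<Longrightarrow> j \<in> I \<Longrightarrow> k \<in> I \<Longrightarrow> i \<noteq> j \<Longrightarrow> j \<noteq> k \<Longrightarrow> i \<noteq> k \<Longrightarrow>
      \<beta> i \<noteq> [] \<Longrightarrow> \<beta> j \<noteq> [] \<Longrightarrow> \<beta> k \<noteq> [] \<Longrightarrow>
      \<not> (hd (\<beta> i) \<sim>\<^sub>q hd (\<beta> j) \<and> hd (\<beta> j) \<sim>\<^sub>q hd (\<beta> k))"
  using assms unfolding admissible_def by blast+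

text \<open>Let \<open>d\<close> be the common conjugate. Subtracting its defining equations for
  \<open>b\<close> and \<open>c\<close>, which have the same trace, and cancelling
  \<open>b - c\<close> gives \<open>d = quat_of_real (2 * qre b) - a\<close>. Then \<open>a\<close>
  is the conjugate of \<open>d\<close> and lies in the class of \<open>b\<close>, which is
  excluded.\<close>

lemma quat_conj_by_diff_inj:
  assumes "b \<noteq> a" "c \<noteq> a" "b \<sim>\<^sub>q c" "\<not> a \<sim>\<^sub>q b"
    and eq: "quat_conj_by (b - a) b = quat_conj_by (c - a) c"
  shows "b = c"
proof (rule ccontr)
  assume "b \<noteq> c"
  define d where "d = quat_conj_by (b - a) b"
  have b: "(b - a) * d = b * (b - a)"
    using assms(1) by (simp add: d_def times_quat_conj_by)
  have c: "(c - a) * d = c * (c - a)"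
    using assms(2) unfolding d_def eq by (simp add: times_quat_conj_by)
  have "b * quat_cnj b = c * quat_cnj c"
    using assms(3) by (simp add: times_quat_cnj quat_similar_iff)
  then have sq: "b * b - c * c = (b - c) * quat_of_real (2 * qre b)"
    using assms(3) by (simp add: quat_cnj_eq quat_similar_iff algebra_simps)
  have "(b - c) * d = b * (b - a) - c * (c - a)"
    by (simp add: b[symmetric] c[symmetric] left_diff_distrib)
  also have "\<dots> = (b - c) * (quat_of_real (2 * qre b) - a)"
    using sq by (simp add: right_diff_distrib) (simp add: algebra_simps)
  finally have "d = quat_of_real (2 * qre b) - a"
    using \<open>b \<noteq> c\<close> by simp
  moreover have "d \<sim>\<^sub>q b"
    using assms(1) by (simp add: d_def quat_conj_by_similar)
  ultimately have "a = quat_cnj d"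
    by (simp add: quat_cnj_eq quat_similar_iff)
  with \<open>d \<sim>\<^sub>q b\<close> assms(4) show False
    by simp
qed

text \<open>Every remaining head stays in the class of the old one, so the condition on triples
  carries over at once. The work lies in keeping the heads distinct.\<close>

lemma admissible_peel:
  assumes adm: "admissible I \<beta>" and l: "l \<in> I" "\<beta> l = a # as"
  shows "admissible I (\<lambda>i. if i = l then as else shift_chain a (\<beta> i))"
proof -
  define \<gamma> where "\<gamma> = (\<lambda>i. if i = l then as else shift_chain a (\<beta> i))"
  have \<gamma>: "\<gamma> l = as" "\<And>i. i \<noteq> l \<Longrightarrow> \<gamma> i = shift_chain a (\<beta> i)"
    by (simp_all add: \<gamma>_def)
  note chain = admissibleD(1)[OF adm] and three = admissibleD(3)[OF adm]
  have neq: "hd (\<beta> i) \<noteq> a" if "i \<in> I" "i \<noteq> l" "\<beta> i \<noteq> []" for i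
    using admissibleD(2)[OF adm that(1) l(1) that(2,3)] l(2) by simp
  have as: "successively chain_step as" "as \<noteq> [] \<Longrightarrow> chain_step a (hd as)"
    using chain[OF l(1)] l(2) by (auto simp: successively_Cons)
  have nonempty: "\<beta> i \<noteq> []" if "\<gamma> i \<noteq> []" for i
    using that l(2) \<gamma>(2)[of i] by (cases "i = l") auto
  have sim: "hd (\<gamma> i) \<sim>\<^sub>q hd (\<beta> i)" if "i \<in> I" "\<gamma> i \<noteq> []" for i
  proof (cases "i = l")
    case True
    with as(2) that l(2) \<gamma>(1) show ?thesis
      by (auto simp: chain_step_def intro: quat_similar_sym)
  next
    case False
    with that neq[of i] \<gamma>(2)[OF False] show ?thesis
      by (simp add: hd_shift_chain quat_conj_by_similar)
  qed
  have hd_\<gamma>: "hd (\<gamma> i) = quat_conj_by (hd (\<beta> i) - a) (hd (\<beta> i))"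
    if "i \<noteq> l" "\<gamma> i \<noteq> []" for i
    using that nonempty[of i] by (simp add: \<gamma>(2) hd_shift_chain)
  have distinct_l: "hd (\<gamma> i) \<noteq> hd as" if i: "i \<in> I" "i \<noteq> l" "\<gamma> i \<noteq> []" "as \<noteq> []" for i
  proof
    assume eq: "hd (\<gamma> i) = hd as"
    have b: "hd (\<beta> i) \<noteq> a"
      using i nonempty neq by blast
    have step: "a \<sim>\<^sub>q hd as" "hd as \<noteq> quat_cnj a"
      using as(2)[OF i(4)] by (simp_all add: chain_step_def)
    \<comment> \<open>Similarity makes the new head of chain \<open>i\<close> the conjugate of
      \<open>a\<close>, which \<open>hd as\<close> is not allowed to be.\<close>
    have "a \<sim>\<^sub>q hd (\<beta> i)"
      using quat_similar_trans[OF step(1)] sim[OF i(1,3)] eq by simp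
    with b eq step(2) hd_\<gamma>[OF i(2,3)] show False
      by (simp add: quat_conj_by_diff_similar)
  qed
  have distinct: "hd (\<gamma> i) \<noteq> hd (\<gamma> j)"
    if ij: "i \<in> I" "j \<in> I" "i \<noteq> j" "\<gamma> i \<noteq> []" "\<gamma> j \<noteq> []" for i j
  proof (cases "i = l \<or> j = l")
    case True
    then show ?thesis
      using distinct_l[of i] distinct_l[of j] ij \<gamma>(1) by metis
  next
    case False
    have ne: "\<beta> i \<noteq> []" "\<beta> j \<noteq> []"
      using nonempty ij by blast+
    show ?thesis
    proof
      assume eq: "hd (\<gamma> i) = hd (\<gamma> j)"
      have s: "hd (\<beta> i) \<sim>\<^sub>q hd (\<beta> j)"
        using sim[OF ij(1,4)] sim[OF ij(2,5)] eq by (simp add: quat_similar_iff)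
      \<comment> \<open>Otherwise the heads of chains \<open>l\<close>, \<open>i\<close> and
        \<open>j\<close> would be three in one class.\<close>
      have "\<not> a \<sim>\<^sub>q hd (\<beta> i)"
        using three[of l i j] l ij ne False s by auto
      moreover have "quat_conj_by (hd (\<beta> i) - a) (hd (\<beta> i)) =
          quat_conj_by (hd (\<beta> j) - a) (hd (\<beta> j))"
        using eq ij False by (simp add: hd_\<gamma>)
      moreover have "hd (\<beta> i) \<noteq> a" "hd (\<beta> j) \<noteq> a"
        using neq ij ne False by blast+
      ultimately have "hd (\<beta> i) = hd (\<beta> j)"
        using s quat_conj_by_diff_inj by blast
      with admissibleD(2)[OF adm ij(1-3) ne] show False
        by simp
    qed
  qed
  have "successively chain_step (\<gamma> i)" if "i \<in> I" for i
  proof (cases "i = l")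
    case True
    with as(1) \<gamma>(1) show ?thesis
      by simp
  next
    case False
    with chain[OF that] neq[OF that] show ?thesis
      by (auto simp: \<gamma>(2) intro: successively_shift_chain)
  qed
  moreover have "\<not> (hd (\<gamma> i) \<sim>\<^sub>q hd (\<gamma> j) \<and> hd (\<gamma> j) \<sim>\<^sub>q hd (\<gamma> k))"
    if ijk: "i \<in> I" "j \<in> I" "k \<in> I" "i \<noteq> j" "j \<noteq> k" "i \<noteq> k"
      "\<gamma> i \<noteq> []" "\<gamma> j \<noteq> []" "\<gamma> k \<noteq> []" for i j k
    using three[OF ijk(1-6) nonempty[OF ijk(7)] nonempty[OF ijk(8)] nonempty[OF ijk(9)]]
      sim[OF ijk(1,7)] sim[OF ijk(2,8)] sim[OF ijk(3,9)]
    by (simp add: quat_similar_iff)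
  ultimately have "admissible I \<gamma>"
    using distinct unfolding admissible_def by blast
  then show ?thesis
    by (simp only: \<gamma>_def)
qed

lemma admissible_common_multiple_eq_0:
  assumes "finite I" "admissible I \<beta>"
    and "\<And>i. i \<in> I \<Longrightarrow> f \<in> right_ideal_gen (chain_poly (\<beta> i))"
    and "deg_less (\<Sum>i\<in>I. length (\<beta> i)) f"
  shows "f = 0"
  using assms(2-)
proof (induction "\<Sum>i\<in>I. length (\<beta> i)" arbitrary: \<beta> f)
  case 0
  then show ?case
    by simp
next
  case (Suc n)
  from Suc.hyps(2) obtain l where l: "l \<in> I" "\<beta> l \<noteq> []"
    by (metis list.size(3) sum.neutral nat.distinct(1))
  then obtain a as where a: "\<beta> l = a # as"
    by (cases "\<beta> l") auto
  from Suc.prems(2)[OF l(1)] obtain g where f: "f = (qX - qconst a) * (chain_poly as * g)"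
    by (auto simp: a right_ideal_gen_iff mult.assoc)
  let ?\<beta> = "\<lambda>i. if i = l then as else shift_chain a (\<beta> i)"
  \<comment> \<open>Shifting preserves lengths, so peeling lowers the total length by one, just as
    it lowers the degree bound.\<close>
  have "(\<Sum>i\<in>I. length (\<beta> i)) = Suc (\<Sum>i\<in>I. length (?\<beta> i))"
    using assms(1) l(1) by (simp add: sum.remove[of I l] a)
  with Suc.hyps(2) have n: "n = (\<Sum>i\<in>I. length (?\<beta> i))"
    by simp
  have "chain_poly as * g = 0"
  proof (rule Suc.hyps(1)[of ?\<beta>])
    show "admissible I ?\<beta>"
      using Suc.prems(1) l(1) a by (rule admissible_peel)
    show "deg_less (\<Sum>i\<in>I. length (?\<beta> i)) (chain_poly as * g)"
      using monic_deg_times_deg_less[OF monic_deg_linear, of n a "chain_poly as * g"]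
        Suc.prems(3) Suc.hyps(2) n f by simp
    show "chain_poly as * g \<in> right_ideal_gen (chain_poly (?\<beta> i))" if "i \<in> I" for i
    proof (cases "i = l")
      case True
      then show ?thesis
        by (auto simp: right_ideal_gen_iff)
    next
      case False
      have "chain_poly as * g \<in> right_ideal_gen (chain_poly (shift_chain a (\<beta> i)))"
      proof (rule shift_chain_ideal)
        show "successively chain_step (\<beta> i)"
          using admissibleD(1)[OF Suc.prems(1) that] .
        show "\<beta> i = [] \<or> hd (\<beta> i) \<noteq> a"
          using admissibleD(2)[OF Suc.prems(1) that l(1) False _ l(2)] a by auto
        show "(qX - qconst a) * (chain_poly as * g) \<in> right_ideal_gen (chain_poly (\<beta> i))"
          using Suc.prems(2)[OF that] f by simp
      qed
      with False show ?thesis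
        by simp
    qed
  qed (rule n)
  with f show ?case
    by simp
qed

section \<open>Newton interpolation\<close>

text \<open>The successive quotients strip exactly the linear factors of the chain product.\<close>

lemma left_ddiff_snoc_chain_poly: "left_ddiff (as @ [a]) (chain_poly as * g) = left_eval g a"
proof (induction as)
  case (Cons b as)
  have "left_quot b (chain_poly (b # as) * g) = chain_poly as * g"
    by (rule left_quot_unique(2)[of _ 0]) (simp add: mult.assoc)
  with Cons show ?case
    by (simp add: left_ddiff_Cons)
qed (simp add: left_ddiff_single)

lemma chain_poly_append: "chain_poly (as @ bs) = chain_poly as * chain_poly bs"
  by (simp add: chain_poly_def)

lemma left_eval_eq_0D: "left_eval g a = 0 \<Longrightarrow> \<exists>u. g = (qX - qconst a) * u"
  using left_quot_eq[of g a] by auto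

text \<open>Modulo the right ideal of \<open>qX - qconst a\<close>, the product
  \<open>g * qX\<close> is \<open>qX\<close> times the value of \<open>g\<close>.\<close>

lemma left_eval_times_qX: "left_eval (g * qX) a = a * left_eval g a"
proof -
  have "g * qX = qX * qconst (left_eval g a) + (qX - qconst a) * (left_quot a g * qX)"
    using arg_cong[OF left_quot_eq[of g a], of "\<lambda>p. p * qX"]
    by (simp only: distrib_right mult.assoc qX_commutes)
  moreover have "left_eval (qX * qconst r) a = a * r" for r
    by (simp add: left_eval_times_qconst) (simp add: qX_def left_eval_single)
  ultimately show ?thesis
    by (simp add: left_eval_add)
qed

text \<open>If \<open>v\<close> is the value of the cofactor \<open>g\<close> at \<open>a\<close>,
  then \<open>g * (qX - qconst d)\<close> has the value \<open>a * v - v * d\<close>, which vanishes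
  for \<open>d = inverse v * a * v\<close>. The new factor stands on the right, so the product
  remains in every right ideal containing \<open>G\<close>.\<close>

lemma newton_step:
  assumes G: "G \<in> right_ideal_gen (chain_poly as)" and v: "left_ddiff (as @ [a]) G \<noteq> 0"
  shows "G * (qX - qconst (quat_conj_by (left_ddiff (as @ [a]) G) a))
    \<in> right_ideal_gen (chain_poly (as @ [a]))"
proof -
  let ?v = "left_ddiff (as @ [a]) G"
  let ?d = "quat_conj_by ?v a"
  from G obtain g where g: "G = chain_poly as * g"
    by (auto simp: right_ideal_gen_iff)
  then have "?v = left_eval g a"
    by (simp add: left_ddiff_snoc_chain_poly)
  moreover have "left_eval (g * (qX - qconst ?d)) a = left_eval (g * qX) a - left_eval (g * qconst ?d) a"
    using left_eval_add[of "g * (qX - qconst ?d)" "g * qconst ?d" a]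
    by (simp add: right_diff_distrib)
  ultimately have "left_eval (g * (qX - qconst ?d)) a = 0"
    using times_quat_conj_by[OF v, of a] by (simp add: left_eval_times_qX left_eval_times_qconst)
  then obtain u where "g * (qX - qconst ?d) = (qX - qconst a) * u"
    using left_eval_eq_0D by blast
  then show ?thesis
    by (auto simp: g chain_poly_append right_ideal_gen_iff mult.assoc)
qed

text \<open>The data are total functions, so the same \<open>c\<close> serves when a chain is
  truncated.\<close>

definition interpolates ::
    "'i set \<Rightarrow> ('i \<Rightarrow> quat list) \<Rightarrow> ('i \<Rightarrow> nat \<Rightarrow> quat) \<Rightarrow> qpoly \<Rightarrow> bool" where
  "interpolates I \<beta> c f \<longleftrightarrow>
     (\<forall>i\<in>I. \<forall>j<length (\<beta> i). left_ddiff (take (Suc j) (\<beta> i)) f = c i j)"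

lemma interpolates_zero_iff:
  "interpolates I \<beta> (\<lambda>i j. 0) f \<longleftrightarrow> (\<forall>i\<in>I. f \<in> right_ideal_gen (chain_poly (\<beta> i)))"
  by (simp add: interpolates_def left_ddiffs_zero_iff)

lemma interpolates_diff:
  "interpolates I \<beta> c f \<Longrightarrow> interpolates I \<beta> d g \<Longrightarrow> interpolates I \<beta> (\<lambda>i j. c i j - d i j) (f - g)"
  by (simp add: interpolates_def left_ddiff_diff)

lemma interpolates_add:
  "interpolates I \<beta> c f \<Longrightarrow> interpolates I \<beta> d g \<Longrightarrow> interpolates I \<beta> (\<lambda>i j. c i j + d i j) (f + g)"
  by (simp add: interpolates_def left_ddiff_add)

lemma interpolates_zero_times:
  "interpolates I \<beta> (\<lambda>i j. 0) f \<Longrightarrow> interpolates I \<beta> (\<lambda>i j. 0) (f * g)"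
  by (simp add: interpolates_zero_iff right_ideal_gen_times)

text \<open>Dropping a last element changes no head of a chain that stays nonempty.\<close>

lemma admissible_truncate:
  assumes "admissible I \<beta>" "\<beta> l = as @ [a]"
  shows "admissible I (\<beta>(l := as))"
proof -
  note adm = admissibleD[OF assms(1)]
  have chain: "successively chain_step ((\<beta>(l := as)) i)" if "i \<in> I" for i
    using adm(1)[of i] assms(2) that by (cases "i = l") (auto simp: successively_append_iff)
  have hd: "\<beta> i \<noteq> [] \<and> hd ((\<beta>(l := as)) i) = hd (\<beta> i)" if "(\<beta>(l := as)) i \<noteq> []" for i
    using that assms(2) by (cases "i = l") auto
  show ?thesis
    unfolding admissible_def
  proof (intro conjI ballI impI)
    fix i j
    assume "i \<in> I" "j \<in> I" "i \<noteq> j" "(\<beta>(l := as)) i \<noteq> []" "(\<beta>(l := as)) j \<noteq> []"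
    then show "hd ((\<beta>(l := as)) i) \<noteq> hd ((\<beta>(l := as)) j)"
      using adm(2)[of i j] hd[of i] hd[of j] by argo
  next
    fix i j k
    assume "i \<in> I" "j \<in> I" "k \<in> I" "i \<noteq> j" "j \<noteq> k" "i \<noteq> k"
      "(\<beta>(l := as)) i \<noteq> []" "(\<beta>(l := as)) j \<noteq> []" "(\<beta>(l := as)) k \<noteq> []"
    then show "\<not> (hd ((\<beta>(l := as)) i) \<sim>\<^sub>q hd ((\<beta>(l := as)) j) \<and>
        hd ((\<beta>(l := as)) j) \<sim>\<^sub>q hd ((\<beta>(l := as)) k))"
      using adm(3)[of i j k] hd[of i] hd[of j] hd[of k] by argo
  qed (rule chain)
qed

text \<open>Induction on the total length, restoring the last element of one chain. Both polynomials
  are built together because \<open>f\<close> is corrected by a right multiple of the previous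
  \<open>G\<close>.\<close>

lemma newton_interpolation:
  assumes "finite I" "admissible I \<beta>"
  defines "N \<equiv> \<Sum>i\<in>I. length (\<beta> i)"
  shows "\<exists>G. monic_deg N G \<and> interpolates I \<beta> (\<lambda>i j. 0) G"
    and "\<exists>f. deg_less N f \<and> interpolates I \<beta> c f"
proof -
  have "(\<exists>G. monic_deg N G \<and> interpolates I \<beta> (\<lambda>i j. 0) G) \<and>
        (\<exists>f. deg_less N f \<and> interpolates I \<beta> c f)"
    using assms(2) unfolding N_def
  proof (induction "\<Sum>i\<in>I. length (\<beta> i)" arbitrary: \<beta>)
    case 0
    then have "\<forall>i\<in>I. \<beta> i = []"
      using assms(1) by simp
    then show ?case
      by (auto simp: interpolates_def intro!: exI[of _ "1 :: qpoly"])
  next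
    case (Suc n)
    from Suc.hyps(2) obtain l where l: "l \<in> I" "\<beta> l \<noteq> []"
      by (metis list.size(3) sum.neutral nat.distinct(1))
    then obtain as a where a: "\<beta> l = as @ [a]"
      by (cases "\<beta> l" rule: rev_cases) auto
    let ?\<beta> = "\<beta>(l := as)"
    have "(\<Sum>i\<in>I. length (\<beta> i)) = Suc (\<Sum>i\<in>I. length (?\<beta> i))"
      using assms(1) l(1) by (simp add: sum.remove[of I l] a)
    with Suc.hyps(2) have n: "n = (\<Sum>i\<in>I. length (?\<beta> i))"
      by simp
    \<comment> \<open>The single added condition has index \<open>length as\<close>, where the
      prefix is the whole chain.\<close>
    have step: "interpolates I \<beta> d f \<longleftrightarrow>
        interpolates I ?\<beta> d f \<and> left_ddiff (\<beta> l) f = d l (length as)" for d f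
    proof -
      have "(\<forall>j<length (\<beta> l). left_ddiff (take (Suc j) (\<beta> l)) f = d l j) \<longleftrightarrow>
          (\<forall>j<length as. left_ddiff (take (Suc j) as) f = d l j) \<and>
          left_ddiff (\<beta> l) f = d l (length as)"
        by (auto simp: a less_Suc_eq)
      then show ?thesis
        unfolding interpolates_def using l(1) by (simp add: fun_upd_def) metis
    qed
    from Suc.hyps(1)[OF n admissible_truncate[OF Suc.prems a]] n obtain G f where
      G: "monic_deg n G" "interpolates I ?\<beta> (\<lambda>i j. 0) G" and
      f: "deg_less n f" "interpolates I ?\<beta> c f"
      by auto
    define v where "v = left_ddiff (\<beta> l) G"
    \<comment> \<open>If \<open>v\<close> were zero, \<open>G\<close> of degree \<open>n\<close>
      would lie in all the ideals, although their nonzero common elements have degree at least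
      \<open>Suc n\<close>.\<close>
    have "v \<noteq> 0"
    proof
      assume "v = 0"
      with G(2) have "interpolates I \<beta> (\<lambda>i j. 0) G"
        by (simp add: step v_def)
      moreover have "deg_less (\<Sum>i\<in>I. length (\<beta> i)) G"
        using G(1) Suc.hyps(2) by (simp add: monic_deg_def)
      ultimately have "G = 0"
        using admissible_common_multiple_eq_0[OF assms(1) Suc.prems]
        by (simp add: interpolates_zero_iff)
      with G(1) show False
        using monic_deg_nonzero by blast
    qed
    let ?G = "G * (qX - qconst (quat_conj_by v a))"
    have "interpolates I ?\<beta> (\<lambda>i j. 0) ?G"
      using G(2) by (rule interpolates_zero_times)
    moreover have "left_ddiff (\<beta> l) ?G = 0"
    proof -
      have "?G \<in> right_ideal_gen (chain_poly (\<beta> l))"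
        using newton_step[of G as a] G(2) l(1) \<open>v \<noteq> 0\<close>
        by (auto simp: interpolates_zero_iff a v_def)
      then show ?thesis
        using left_ddiffs_zero_iff[of "\<beta> l" ?G] by (auto simp: a less_Suc_eq)
    qed
    moreover have "monic_deg (Suc n) ?G"
      using monic_deg_times[OF G(1) monic_deg_linear] by simp
    \<comment> \<open>The correction \<open>G * qconst e\<close> changes the new divided difference
      by \<open>v * e\<close> and leaves the earlier ones fixed.\<close>
    moreover define e where "e = inverse v * (c l (length as) - left_ddiff (\<beta> l) f)"
    have "interpolates I ?\<beta> c (f + G * qconst e)"
      using interpolates_add[OF f(2) interpolates_zero_times[OF G(2)]] by simp
    moreover have "left_ddiff (\<beta> l) (f + G * qconst e) = c l (length as)"
      using \<open>v \<noteq> 0\<close>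
      by (simp add: left_ddiff_add left_ddiff_times_qconst e_def flip: v_def mult.assoc)
    moreover have "deg_less (Suc n) (f + G * qconst e)"
      using deg_less_mono[OF f(1), of "Suc n"] G(1)
      by (simp add: monic_deg_def deg_less_add deg_less_times_qconst)
    ultimately show ?case
      using Suc.hyps(2) by (metis step)
  qed
  then show "\<exists>G. monic_deg N G \<and> interpolates I \<beta> (\<lambda>i j. 0) G"
    and "\<exists>f. deg_less N f \<and> interpolates I \<beta> c f"
    by auto
qed

lemma interpolant_unique:
  assumes "finite I" "admissible I \<beta>"
    and "interpolates I \<beta> c f" "deg_less (\<Sum>i\<in>I. length (\<beta> i)) f"
    and "interpolates I \<beta> c g" "deg_less (\<Sum>i\<in>I. length (\<beta> i)) g"
  shows "f = g"
proof -
  have "f - g = 0"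
  proof (rule admissible_common_multiple_eq_0[OF assms(1,2)])
    show "deg_less (\<Sum>i\<in>I. length (\<beta> i)) (f - g)"
      using assms(4,6) by (rule deg_less_diff)
    show "f - g \<in> right_ideal_gen (chain_poly (\<beta> i))" if "i \<in> I" for i
      using interpolates_diff[OF assms(3,5)] that by (simp add: interpolates_zero_iff)
  qed
  then show ?thesis
    by simp
qed

section \<open>Monic generators and the least right common multiple\<close>

lemma qmonic_iff: "qmonic G \<longleftrightarrow> (\<exists>d. monic_deg d G)"
  by (auto simp: qmonic_def monic_deg_def deg_less_def Suc_le_eq)

text \<open>The ideal of a monic polynomial contains no nonzero element of smaller degree. Hence the
  degrees agree, and the difference of the generators, where the leading terms cancel,
  vanishes.\<close>

lemma monic_generator_unique:
  assumes "monic_deg d G" "monic_deg e H" "right_ideal_gen G = right_ideal_gen H"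
  shows "G = H"
proof -
  have no_small: "f = 0" if "monic_deg m K" "f \<in> right_ideal_gen K" "deg_less m f" for m K f
    using that monic_deg_times_eq_0[of m K] by (auto simp: right_ideal_gen_iff)
  have "G \<in> right_ideal_gen H" "H \<in> right_ideal_gen G"
    using assms(3) by (auto simp: right_ideal_gen_iff intro: exI[of _ 1])
  have "d = e"
  proof (rule ccontr)
    assume "d \<noteq> e"
    then consider "Suc d \<le> e" | "Suc e \<le> d"
      by linarith
    then show False
    proof cases
      case 1
      then have "deg_less e G"
        using assms(1) by (auto simp: monic_deg_def intro: deg_less_mono)
      then show False
        using no_small[OF assms(2) \<open>G \<in> _\<close>] monic_deg_nonzero[OF assms(1)] by simp
    next
      case 2
      then have "deg_less d H"
        using assms(2) by (auto simp: monic_deg_def intro: deg_less_mono)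
      then show False
        using no_small[OF assms(1) \<open>H \<in> _\<close>] monic_deg_nonzero[OF assms(2)] by simp
    qed
  qed
  have "Poly_Mapping.lookup (G - H) j = 0" if "d \<le> j" for j
    using assms(1,2) \<open>d = e\<close> that
    by (cases "j = d") (auto simp: monic_deg_def deg_less_def lookup_minus)
  then have "deg_less d (G - H)"
    by (simp add: deg_less_def)
  moreover have "G - H \<in> right_ideal_gen G"
    using assms(3) \<open>G \<in> _\<close> \<open>H \<in> _\<close> by (simp add: right_ideal_gen_diff)
  ultimately have "G - H = 0"
    by (intro no_small[OF assms(1)])
  then show ?thesis
    by simp
qed

lemma lrcm_eqI:
  assumes "monic_deg d G" "right_ideal_gen G = (\<Inter>f\<in>F. right_ideal_gen f)"
  shows "lrcm F = G"
  unfolding lrcm_def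
  by (rule the_equality)
    (use assms in \<open>auto simp: qmonic_iff intro: monic_generator_unique\<close>)

text \<open>The Newton polynomial \<open>G\<close> generates the intersection: division by
  \<open>G\<close> leaves a remainder in all the ideals, which the degree bound makes zero.\<close>

lemma interpolates_zero_iff_lrcm:
  assumes "finite I" "admissible I \<beta>"
  shows "interpolates I \<beta> (\<lambda>i j. 0) f \<longleftrightarrow>
    f \<in> right_ideal_gen (lrcm ((\<lambda>i. chain_poly (\<beta> i)) ` I))"
proof -
  obtain G where G: "monic_deg (\<Sum>i\<in>I. length (\<beta> i)) G" "interpolates I \<beta> (\<lambda>i j. 0) G"
    using newton_interpolation(1)[OF assms] by blast
  have gen: "interpolates I \<beta> (\<lambda>i j. 0) f \<longleftrightarrow> f \<in> right_ideal_gen G" for f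
  proof
    assume f: "interpolates I \<beta> (\<lambda>i j. 0) f"
    obtain q r where qr: "f = G * q + r" "deg_less (\<Sum>i\<in>I. length (\<beta> i)) r"
      using monic_division[OF G(1)] by blast
    have "interpolates I \<beta> (\<lambda>i j. 0) (f - G * q)"
      using f G(2)
      by (auto simp: interpolates_zero_iff intro!: right_ideal_gen_diff right_ideal_gen_times)
    then have "r = 0"
      using qr by (intro admissible_common_multiple_eq_0[OF assms]) (auto simp: interpolates_zero_iff)
    with qr(1) show "f \<in> right_ideal_gen G"
      by (auto simp: right_ideal_gen_iff)
  next
    assume "f \<in> right_ideal_gen G"
    with G(2) show "interpolates I \<beta> (\<lambda>i j. 0) f"
      by (auto simp: interpolates_zero_iff right_ideal_gen_iff[of f G] intro: right_ideal_gen_times)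
  qed
  have "lrcm ((\<lambda>i. chain_poly (\<beta> i)) ` I) = G"
    using G(1) by (rule lrcm_eqI) (use gen in \<open>auto simp: interpolates_zero_iff\<close>)
  with gen show ?thesis
    by simp
qed


section \<open>The confluent Vandermonde matrix\<close>

definition poly_of_vec :: "quat vec \<Rightarrow> qpoly" where
  "poly_of_vec x = (\<Sum>j<dim_vec x. qX ^ j * qconst (x $ j))"

lemma lookup_poly_of_vec:
  "Poly_Mapping.lookup (poly_of_vec x) j = (if j < dim_vec x then x $ j else 0)"
proof -
  have "Poly_Mapping.lookup (poly_of_vec x) j = (\<Sum>i<dim_vec x. if i = j then x $ i else 0)"
    unfolding poly_of_vec_def lookup_sum
    by (intro sum.cong refl) (simp add: qX_power lookup_single when_def)
  then show ?thesis
    by simp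
qed

lemma deg_less_poly_of_vec: "x \<in> carrier_vec N \<Longrightarrow> deg_less N (poly_of_vec x)"
  by (auto simp: deg_less_def lookup_poly_of_vec)

lemma poly_of_vec_inj:
  assumes "x \<in> carrier_vec N" "y \<in> carrier_vec N" "poly_of_vec x = poly_of_vec y"
  shows "x = y"
proof (rule eq_vecI)
  show "x $ j = y $ j" if "j < dim_vec y" for j
    using assms that lookup_poly_of_vec[of x j] lookup_poly_of_vec[of y j] by auto
qed (use assms in auto)

lemma poly_of_vec_surj:
  assumes "deg_less N f"
  shows "\<exists>x\<in>carrier_vec N. f = poly_of_vec x"
proof (rule bexI[of _ "vec N (Poly_Mapping.lookup f)"])
  show "f = poly_of_vec (vec N (Poly_Mapping.lookup f))"
    using assms by (intro poly_mapping_eqI) (simp add: lookup_poly_of_vec deg_less_def)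
qed simp

lemma scalar_prod_qX_powers:
  assumes "x \<in> carrier_vec N"
  shows "vec N (\<lambda>j. qX ^ j) \<bullet> map_vec qconst x = poly_of_vec x"
  using assms by (simp add: scalar_prod_def poly_of_vec_def lessThan_atLeast0)

text \<open>By right linearity a matrix row times a coefficient vector is the divided difference of
  the corresponding polynomial.\<close>

lemma vandermonde_block_mult_vec:
  assumes "x \<in> carrier_vec m"
  shows "vandermonde_block m as *\<^sub>v x =
    vec (length as) (\<lambda>i. left_ddiff (take (Suc i) as) (poly_of_vec x))"
proof (rule eq_vecI)
  fix i
  assume "i < dim_vec (vec (length as) (\<lambda>i. left_ddiff (take (Suc i) as) (poly_of_vec x)))"
  with assms show "(vandermonde_block m as *\<^sub>v x) $ i =
      vec (length as) (\<lambda>i. left_ddiff (take (Suc i) as) (poly_of_vec x)) $ i"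
    by (simp add: vandermonde_block_def scalar_prod_def poly_of_vec_def left_ddiff_sum
        left_ddiff_times_qconst lessThan_atLeast0)
qed (simp add: vandermonde_block_def)

lemma stack_vecs_simps [simp]:
  "stack_vecs [] = vNil" "stack_vecs (v # vs) = v @\<^sub>v stack_vecs vs"
  by (simp_all add: stack_vecs_def)

lemma stack_vecs_carrier:
  assumes "\<And>i. i \<in> set is \<Longrightarrow> v i \<in> carrier_vec (k i)"
  shows "stack_vecs (map v is) \<in> carrier_vec (sum_list (map k is))"
  using assms
proof (induction "is")
  case (Cons i "is")
  then have "v i \<in> carrier_vec (k i)" "stack_vecs (map v is) \<in> carrier_vec (sum_list (map k is))"
    by simp_all
  then show ?case
    by (simp only: list.map stack_vecs_simps sum_list.Cons append_carrier_vec)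
qed simp

lemma stack_vecs_eq_iff:
  assumes "\<And>i. i \<in> set is \<Longrightarrow> v i \<in> carrier_vec (k i)" "\<And>i. i \<in> set is \<Longrightarrow> w i \<in> carrier_vec (k i)"
  shows "stack_vecs (map v is) = stack_vecs (map w is) \<longleftrightarrow> (\<forall>i\<in>set is. v i = w i)"
  using assms
proof (induction "is")
  case (Cons i "is")
  then have IH: "stack_vecs (map v is) = stack_vecs (map w is) \<longleftrightarrow> (\<forall>i\<in>set is. v i = w i)"
    by simp
  have "v i \<in> carrier_vec (k i)" "w i \<in> carrier_vec (k i)"
    using Cons.prems by simp_all
  then show ?case
    by (simp only: list.map stack_vecs_simps append_vec_eq IH list.set ball_simps)
qed simp

lemma stack_vecs_surj:
  assumes "distinct is" "w \<in> carrier_vec (sum_list (map k is))"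
  shows "\<exists>c. w = stack_vecs (map (\<lambda>i. vec (k i) (c i)) is)"
  using assms
proof (induction "is" arbitrary: w)
  case Nil
  then show ?case
    by auto
next
  case (Cons i "is")
  let ?m = "sum_list (map k is)"
  have w: "w = vec_first w (k i) @\<^sub>v vec_last w ?m"
    using Cons.prems(2) by simp
  obtain c where c: "vec_last w ?m = stack_vecs (map (\<lambda>i. vec (k i) (c i)) is)"
    using Cons.IH[of "vec_last w ?m"] Cons.prems(1) by auto
  \<comment> \<open>Distinctness ensures that the update at \<open>i\<close> does not disturb the
    data of the tail.\<close>
  let ?c = "c(i := \<lambda>j. vec_first w (k i) $ j)"
  have tl: "map (\<lambda>i. vec (k i) (?c i)) is = map (\<lambda>i. vec (k i) (c i)) is"
    using Cons.prems(1) by auto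
  have hd: "vec (k i) (?c i) = vec_first w (k i)"
    by (rule eq_vecI) auto
  have "w = stack_vecs (map (\<lambda>i. vec (k i) (?c i)) (i # is))"
    unfolding list.map stack_vecs_simps tl hd c[symmetric] by (rule w)
  then show ?case
    by blast
qed

lemma confluent_vandermonde_simps [simp]:
  "confluent_vandermonde m [] = 0\<^sub>m 0 m"
  "confluent_vandermonde m (a # as) = vandermonde_block m a @\<^sub>r confluent_vandermonde m as"
  by (simp_all add: confluent_vandermonde_def)

lemma confluent_vandermonde_carrier:
  "confluent_vandermonde m (map \<beta> is) \<in>
    carrier_mat (sum_list (map (\<lambda>i. length (\<beta> i)) is)) m"
proof (induction "is")
  case (Cons i "is")
  have "vandermonde_block m (\<beta> i) \<in> carrier_mat (length (\<beta> i)) m"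
    by (simp add: vandermonde_block_def)
  from carrier_append_rows[OF this Cons.IH] show ?case
    by simp
qed simp

lemma confluent_vandermonde_mult_vec:
  assumes "x \<in> carrier_vec m"
  shows "confluent_vandermonde m (map \<beta> is) *\<^sub>v x =
    stack_vecs (map (\<lambda>i. vec (length (\<beta> i))
      (\<lambda>j. left_ddiff (take (Suc j) (\<beta> i)) (poly_of_vec x))) is)"
proof (induction "is")
  case Nil
  show ?case
    by (rule eq_vecI) simp_all
next
  case (Cons i "is")
  have "vandermonde_block m (\<beta> i) \<in> carrier_mat (length (\<beta> i)) m"
    by (simp add: vandermonde_block_def)
  from mat_mult_append[OF this confluent_vandermonde_carrier[of m \<beta> "is"] assms] Cons.IH
  show ?case
    by (simp add: vandermonde_block_mult_vec[OF assms])
qed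

lemma confluent_vandermonde_solves_iff:
  assumes "x \<in> carrier_vec m"
  shows "confluent_vandermonde m (map \<beta> is) *\<^sub>v x =
      stack_vecs (map (\<lambda>i. vec (length (\<beta> i)) (c i)) is) \<longleftrightarrow>
    interpolates (set is) \<beta> c (poly_of_vec x)"
  unfolding confluent_vandermonde_mult_vec[OF assms] interpolates_def
  by (subst stack_vecs_eq_iff[where k = "\<lambda>i. length (\<beta> i)"]) (auto simp: vec_eq_iff)

section \<open>Two-sided inverses of square matrices over a noncommutative ring\<close>

lemma bijective_mat_inverse:
  fixes V :: "'a :: ring_1 mat"
  assumes V: "V \<in> carrier_mat N N"
    and surj: "\<And>w. w \<in> carrier_vec N \<Longrightarrow> \<exists>x\<in>carrier_vec N. V *\<^sub>v x = w"
    and inj: "\<And>x y. x \<in> carrier_vec N \<Longrightarrow> y \<in> carrier_vec N \<Longrightarrow> V *\<^sub>v x = V *\<^sub>v y \<Longrightarrow> x = y"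
  obtains B where "B \<in> carrier_mat N N" "V * B = 1\<^sub>m N" "B * V = 1\<^sub>m N"
proof -
  have "\<forall>j. \<exists>x\<in>carrier_vec N. V *\<^sub>v x = unit_vec N j"
    using surj by simp
  then obtain X where X: "\<And>j. X j \<in> carrier_vec N" "\<And>j. V *\<^sub>v X j = unit_vec N j"
    by metis
  \<comment> \<open>The columns of the right inverse are preimages of the unit vectors.\<close>
  define B where "B = mat N N (\<lambda>(i, j). X j $ i)"
  have B: "B \<in> carrier_mat N N"
    by (simp add: B_def)
  have col_B: "col B j = X j" if "j < N" for j
    using X(1)[of j] that by (intro eq_vecI) (auto simp: B_def)
  have VB: "V * B = 1\<^sub>m N"
    by (rule mat_col_eqI) (use V B X(2) col_B in \<open>auto simp: col_mult2[OF V B]\<close>)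
  have "B * V = 1\<^sub>m N"
  proof (rule mat_col_eqI)
    fix j
    assume "j < dim_col (1\<^sub>m N :: 'a mat)"
    then have j: "j < N"
      by simp
    \<comment> \<open>Since \<open>B\<close> is a right inverse, \<open>V\<close> maps the columns
      of \<open>B * V\<close> and of the identity to the same vectors; injectivity then identifies
      them.\<close>
    have "V * (B * V) = V * 1\<^sub>m N"
      using V B VB by (simp flip: assoc_mult_mat[OF V B V])
    then have "col (V * (B * V)) j = col (V * 1\<^sub>m N) j"
      by simp
    then have "V *\<^sub>v col (B * V) j = V *\<^sub>v col (1\<^sub>m N) j"
      using V B j by (simp only: col_mult2[OF V mult_carrier_mat[OF B V]] col_mult2[OF V one_carrier_mat])
    moreover have "col (B * V) j \<in> carrier_vec N" "col (1\<^sub>m N :: 'a mat) j \<in> carrier_vec N"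
      using V B j by (auto intro!: col_carrier_vec)
    ultimately show "col (B * V) j = col (1\<^sub>m N) j"
      using inj by blast
  qed (use V B in auto)
  with B VB that show thesis
    by blast
qed

lemma inv_mat_eqI:
  fixes A :: "'a :: ring_1 mat"
  assumes A: "A \<in> carrier_mat N N" and B: "B \<in> carrier_mat N N"
    and AB: "A * B = 1\<^sub>m N" and BA: "B * A = 1\<^sub>m N"
  shows "inv_mat A = B"
  unfolding inv_mat_def
proof (rule the_equality)
  show "inverts_mat A B \<and> inverts_mat B A"
    using assms by (auto simp: inverts_mat_def)
  fix C
  assume C: "inverts_mat A C \<and> inverts_mat C A"
  then have AC: "A * C = 1\<^sub>m N" and CA: "C * A = 1\<^sub>m (dim_row C)"
    using A by (auto simp: inverts_mat_def)
  \<comment> \<open>The column counts in the two product equations determine both dimensions of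
    \<open>C\<close>.\<close>
  have C_carrier: "C \<in> carrier_mat N N"
    using arg_cong[OF AC, of dim_col] arg_cong[OF CA, of dim_col] A by auto
  have "C = (B * A) * C"
    using C_carrier by (simp add: BA)
  also have "\<dots> = B"
    using B by (simp add: assoc_mult_mat[OF B A C_carrier] AC)
  finally show "C = B" .
qed

section \<open>The interpolation problem as a linear system\<close>

theorem theorem4p4:
  fixes n :: nat and \<alpha> :: "nat \<Rightarrow> quat list" and c :: "nat \<Rightarrow> nat \<Rightarrow> quat"
  assumes "n \<ge> 1"
    and "\<And>i. i < n \<Longrightarrow> spherical_chain (\<alpha> i)"
    and "\<And>i j. i < n \<Longrightarrow> j < n \<Longrightarrow> i \<noteq> j \<Longrightarrow> hd (\<alpha> i) \<noteq> hd (\<alpha> j)"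
    and "\<And>i j k. i < n \<Longrightarrow> j < n \<Longrightarrow> k < n \<Longrightarrow> i \<noteq> j \<Longrightarrow> j \<noteq> k \<Longrightarrow> i \<noteq> k \<Longrightarrow>
           \<not> (hd (\<alpha> i) \<sim>\<^sub>q hd (\<alpha> j) \<and> hd (\<alpha> j) \<sim>\<^sub>q hd (\<alpha> k))"
  shows
    "let N = (\<Sum>i<n. length (\<alpha> i));
         V = confluent_vandermonde N (map \<alpha> [0..<n]);
         C = stack_vecs (map (\<lambda>i. vec (length (\<alpha> i)) (c i)) [0..<n]);
         G = lrcm ((\<lambda>i. chain_poly (\<alpha> i)) ` {..<n});
         f0 = vec N (\<lambda>j. qX ^ j) \<bullet> map_vec qconst (inv_mat V *\<^sub>v C);
         interp = (\<lambda>f :: qpoly. \<forall>i<n. \<forall>j<length (\<alpha> i).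
                     left_ddiff (take (Suc j) (\<alpha> i)) f = c i j);
         deg_less_N = (\<lambda>f :: qpoly. \<forall>j\<ge>N. Poly_Mapping.lookup f j = 0)
     in V \<in> carrier_mat N N \<and> invertible_mat V
        \<and> {f. interp f} = {f0 + G * h | h. True}
        \<and> interp f0 \<and> deg_less_N f0
        \<and> (\<forall>f. interp f \<and> deg_less_N f \<longrightarrow> f = f0)"
proof -
  define N where "N = (\<Sum>i<n. length (\<alpha> i))"
  define V where "V = confluent_vandermonde N (map \<alpha> [0..<n])"
  define C where "C = stack_vecs (map (\<lambda>i. vec (length (\<alpha> i)) (c i)) [0..<n])"
  define G where "G = lrcm ((\<lambda>i. chain_poly (\<alpha> i)) ` {..<n})"
  define f0 where "f0 = vec N (\<lambda>j. qX ^ j) \<bullet> map_vec qconst (inv_mat V *\<^sub>v C)"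
  have adm: "admissible {..<n} \<alpha>"
    unfolding admissible_def
  proof (intro conjI ballI impI)
    show "successively chain_step (\<alpha> i)" if "i \<in> {..<n}" for i
      using assms(2)[of i] that by (simp add: spherical_chain_iff)
  qed (rule assms(3,4); simp)+
  have N: "sum_list (map (\<lambda>i. length (\<alpha> i)) [0..<n]) = N"
    by (simp add: N_def interv_sum_list_conv_sum_set_nat lessThan_atLeast0)
  have set_n: "set [0..<n] = {..<n}"
    by auto
  have V: "V \<in> carrier_mat N N"
    using confluent_vandermonde_carrier[of N \<alpha> "[0..<n]"] by (simp add: V_def N)
  have C: "C \<in> carrier_vec N"
    using stack_vecs_carrier[of "[0..<n]" "\<lambda>i. vec (length (\<alpha> i)) (c i)" "\<lambda>i. length (\<alpha> i)"]
    by (simp add: C_def N)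
  have solves: "V *\<^sub>v x = stack_vecs (map (\<lambda>i. vec (length (\<alpha> i)) (d i)) [0..<n]) \<longleftrightarrow>
      interpolates {..<n} \<alpha> d (poly_of_vec x)" if "x \<in> carrier_vec N" for x d
    using confluent_vandermonde_solves_iff[OF that, of \<alpha> "[0..<n]" d] by (simp only: V_def set_n)
  note uniq = interpolant_unique[OF finite_lessThan adm, folded N_def]
  have stack: "\<exists>d. w = stack_vecs (map (\<lambda>i. vec (length (\<alpha> i)) (d i)) [0..<n])"
    if "w \<in> carrier_vec N" for w :: "quat vec"
    by (rule stack_vecs_surj) (use that N in simp_all)
  \<comment> \<open>Every right-hand side is a stack of interpolation data, so existence of
    interpolants is surjectivity of \<open>V\<close>.\<close>
  have surj: "\<exists>x\<in>carrier_vec N. V *\<^sub>v x = w" if w: "w \<in> carrier_vec N" for w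
  proof -
    obtain d where d: "w = stack_vecs (map (\<lambda>i. vec (length (\<alpha> i)) (d i)) [0..<n])"
      using stack[OF w] by blast
    obtain f where f: "deg_less N f" "interpolates {..<n} \<alpha> d f"
      using newton_interpolation(2)[OF finite_lessThan adm] unfolding N_def by blast
    obtain x where x: "x \<in> carrier_vec N" "f = poly_of_vec x"
      using poly_of_vec_surj[OF f(1)] by blast
    with f(2) solves[OF x(1), of d] d show ?thesis
      by auto
  qed
  \<comment> \<open>Equal images mean that both coefficient vectors solve the interpolation problem
    for the same data \<open>d\<close>.\<close>
  have inj: "x = y"
    if xy: "x \<in> carrier_vec N" "y \<in> carrier_vec N" and eq: "V *\<^sub>v x = V *\<^sub>v y" for x y
  proof -
    obtain d where d: "V *\<^sub>v y = stack_vecs (map (\<lambda>i. vec (length (\<alpha> i)) (d i)) [0..<n])"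
      using stack[OF mult_mat_vec_carrier[OF V xy(2)]] by blast
    have "poly_of_vec x = poly_of_vec y"
      using solves[OF xy(1), of d] solves[OF xy(2), of d] d eq xy
      by (intro uniq[of d]) (simp_all add: deg_less_poly_of_vec)
    with xy show ?thesis
      by (rule poly_of_vec_inj)
  qed
  obtain B where B: "B \<in> carrier_mat N N" "V * B = 1\<^sub>m N" "B * V = 1\<^sub>m N"
    using bijective_mat_inverse[OF V surj inj] by blast
  have invertible: "invertible_mat V"
    unfolding invertible_mat_def using V B by (auto simp: inverts_mat_def)
  have inv: "inv_mat V = B"
    using V B by (rule inv_mat_eqI)
  have BC: "B *\<^sub>v C \<in> carrier_vec N"
    using B(1) C by simp
  have f0: "f0 = poly_of_vec (B *\<^sub>v C)"
    unfolding f0_def inv using BC by (rule scalar_prod_qX_powers)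
  have deg_f0: "deg_less N f0"
    unfolding f0 using BC by (rule deg_less_poly_of_vec)
  have "V *\<^sub>v (B *\<^sub>v C) = C"
    using C by (simp add: B(2) flip: assoc_mult_mat_vec[OF V B(1) C])
  then have interp_f0: "interpolates {..<n} \<alpha> c f0"
    using solves[OF BC, of c] by (simp add: C_def f0)
  \<comment> \<open>Subtracting the particular solution \<open>f0\<close> leaves the homogeneous
    problem, whose solutions form the right ideal of \<open>G\<close>.\<close>
  have "interpolates {..<n} \<alpha> c f \<longleftrightarrow> (\<exists>h. f = f0 + G * h)" for f
  proof -
    have "interpolates {..<n} \<alpha> c f \<longleftrightarrow> interpolates {..<n} \<alpha> (\<lambda>i j. 0) (f - f0)"
      using interp_f0 by (simp add: interpolates_def left_ddiff_diff)
    also have "\<dots> \<longleftrightarrow> f - f0 \<in> right_ideal_gen G"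
      using interpolates_zero_iff_lrcm[OF finite_lessThan adm] by (simp add: G_def)
    also have "\<dots> \<longleftrightarrow> (\<exists>h. f = f0 + G * h)"
      by (simp add: right_ideal_gen_iff diff_eq_eq add.commute)
    finally show ?thesis .
  qed
  then have solutions: "{f. interpolates {..<n} \<alpha> c f} = {f0 + G * h | h. True}"
    by simp
  have unique: "\<forall>f. interpolates {..<n} \<alpha> c f \<and> deg_less N f \<longrightarrow> f = f0"
    using uniq interp_f0 deg_f0 by blast
  have interp: "(\<forall>i<n. \<forall>j<length (\<alpha> i). left_ddiff (take (Suc j) (\<alpha> i)) f = c i j) \<longleftrightarrow>
      interpolates {..<n} \<alpha> c f" for f
    by (auto simp: interpolates_def)
  show ?thesis
    unfolding Let_def N_def[symmetric] V_def[symmetric] C_def[symmetric] G_def[symmetric]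
      f0_def[symmetric] interp deg_less_def[symmetric]
    by (intro conjI V invertible solutions interp_f0 deg_f0 unique)
qed

end
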